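(* Let $\alpha$ be an exponentially closed ordinal. The following are equivalent: (1) Every $x\subseteq\alpha$ that is $\alpha$-wITRM-computable without parameters is $\alpha$-wITRM-recognizable without parameters. (2) $0$ (i.e., $\emptyset\subseteq\alpha$) is $\alpha$-wITRM-recognizable without parameters. (3) Some $x\subseteq\alpha$ that is $\alpha$-wITRM-computable without parameters is $\alpha$-wITRM-recognizable without parameters. (4) $\alpha$ is wITRM-searchable without parameters.
   Context: An (infinite) ordinal $\alpha$ is exponentially closed if $\beta^{\gamma}<\alpha$ for all $\beta,\gamma<\alpha$ (ordinal exponentiation). Machines. An $\alpha$-register machine program is an ordinary register machine program: a finite list of numbered lines using finitely many registers, each register containing an ordinal $<\alpha$. Commands: increment a register by $1$; copy one register to another; jump to a given line if two register contents agree (otherwise go to the next line); oracle command: for an oracle $x\subseteq\alpha$, replace the content $\iota$ of register $j$ by $1$ if $\iota\in x$ and by $0$ otherwise. Computations run along the ordinals: at successor times the active command is carried out; at limit times the index of the active program line and each register content are the inferior limits of the sequences of their earlier values. If such an inferior limit of register contents equals $\alpha$ (overflow), the computation of an $\alpha$-wITRM is undefined. Inputs and parameters are written in the first registers, all other registers start with $0$. $P^{x}(\vec\xi)\downarrow=c$ means that $P$ with oracle $x$ and input $\vec\xi$ halts with $c$ in the output register. A set $x\subseteq\alpha$ is $\alpha$-wITRM-computable without parameters if there is an $\alpha$-wITRM-program $P$ such that $P(\iota,0)\downarrow=\chi_{x}(\iota)$ for all $\iota<\alpha$. It is $\alpha$-wITRM-recognizable without parameters if there is an $\alpha$-wITRM-program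 $P$ such that, for all $y\subseteq\alpha$, $P^{y}(0)$ is defined and halts with output $1$ if $y=x$ and with output $0$ if $y\neq x$. $\alpha$ is wITRM-searchable without parameters if there is a halting $\alpha$-wITRM-program $P$, run in the parameter $0$, such that the first register used by $P$ contains each element of $\alpha$ at least once before $P$ stops. *)

theory Defs
  imports Main
begin

section \<open>Ordinals\<close>

text \<open>
  The type \<open>'a ordinal\<close> consists of the order types of all well-orders on subsets of \<open>'a\<close>,
  that is, of the ordinals below the cardinal successor of the cardinality of \<open>'a\<close> if \<open>'a\<close> is
  infinite. Every ordinal is an element of \<open>'a ordinal\<close> for a suitable type \<open>'a\<close>, so that
  quantifying over \<open>\<alpha> :: 'a ordinal\<close> with \<open>'a\<close> arbitrary means quantifying over all ordinals.

  The same type also serves as the time axis of computations on ordinals below \<open>\<alpha>\<close>.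
  Let \<open>\<alpha> :: 'a ordinal\<close> be infinite and let \<open>\<kappa>\<close> be the order type of \<open>'a ordinal\<close>, which is a
  regular cardinal greater than \<open>\<alpha>\<close>. Continue a computation that is defined and does not halt
  before \<open>\<kappa>\<close>. It does not overflow at \<open>\<kappa>\<close>, and the configuration at \<open>\<kappa>\<close> also occurs at a closed
  unbounded set of earlier times. Between two of these times no line index and no register
  content is below its value at \<open>\<kappa>\<close>, so the computation cycles forever. Hence every halting
  or overflow time is less than \<open>\<kappa>\<close>. Likewise \<open>\<kappa>\<close> is closed under the arithmetic below.
\<close>

quotient_type 'a ordinal = "'a rel" / partial: "\<lambda>r s. (r, s) \<in> ordIso"
proof (rule part_equivpI)
  show "\<exists>r :: 'a rel. (r, r) \<in> ordIso"
    by (rule exI[of _ "{}"]) (rule ordIso_reflexive, simp add: well_order_on_def linear_order_on_def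
        partial_order_on_def preorder_on_def refl_on_def trans_def antisym_def total_on_def)
  show "symp (\<lambda>r s :: 'a rel. (r, s) \<in> ordIso)"
    by (auto intro: sympI ordIso_symmetric)
  show "transp (\<lambda>r s :: 'a rel. (r, s) \<in> ordIso)"
    by (auto intro: transpI ordIso_transitive)
qed

instantiation ordinal :: (type) wellorder
begin

lift_definition less_eq_ordinal :: "'a ordinal \<Rightarrow> 'a ordinal \<Rightarrow> bool" is "\<lambda>r s. (r, s) \<in> ordLeq"
  by (meson ordIso_iff_ordLeq ordLeq_transitive)

lift_definition less_ordinal :: "'a ordinal \<Rightarrow> 'a ordinal \<Rightarrow> bool" is "\<lambda>r s. (r, s) \<in> ordLess"
  by (meson ordIso_ordLess_trans ordIso_symmetric ordLess_ordIso_trans)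

lemma ordIso_self_Well_order: "(r, r) \<in> ordIso \<longleftrightarrow> Well_order r"
  using ordIso_reflexive by (auto simp: ordIso_def)

instance
proof
  fix x y z :: "'a ordinal"
  show "(x < y) = (x \<le> y \<and> \<not> y \<le> x)"
    by transfer (meson not_ordLeq_iff_ordLess ordLess_imp_ordLeq not_ordLess_ordLeq
        ordIso_self_Well_order)
  show "x \<le> x"
    by transfer (meson ordIso_imp_ordLeq)
  show "x \<le> z" if "x \<le> y" "y \<le> z"
    using that by transfer (rule ordLeq_transitive)
  show "x = y" if "x \<le> y" "y \<le> x"
    using that by transfer (simp add: ordIso_iff_ordLeq)
  show "x \<le> y \<or> y \<le> x"
    by transfer (meson ordLeq_total ordIso_self_Well_order)
next
  fix P :: "'a ordinal \<Rightarrow> bool" and x :: "'a ordinal"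
  assume step: "\<And>x. (\<And>y. y < x \<Longrightarrow> P y) \<Longrightarrow> P x"
  have "wf {(x, y :: 'a ordinal). x < y}"
  proof (rule wf_subset[OF wf_inv_image[OF wf_ordLess, of rep_ordinal]], clarify)
    fix x y :: "'a ordinal"
    assume "x < y"
    then show "(x, y) \<in> inv_image ordLess rep_ordinal"
      by (simp add: less_ordinal_def inv_image_def)
  qed
  then show "P x"
    by (induction x rule: wf_induct_rule) (use step in auto)
qed

end

instantiation ordinal :: (type) conditionally_complete_linorder
begin

definition inf_ordinal :: "'a ordinal \<Rightarrow> 'a ordinal \<Rightarrow> 'a ordinal" where
  "inf_ordinal = min"

definition sup_ordinal :: "'a ordinal \<Rightarrow> 'a ordinal \<Rightarrow> 'a ordinal" where
  "sup_ordinal = max"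

definition Inf_ordinal :: "'a ordinal set \<Rightarrow> 'a ordinal" where
  "Inf_ordinal X = (LEAST x. x \<in> X)"

definition Sup_ordinal :: "'a ordinal set \<Rightarrow> 'a ordinal" where
  "Sup_ordinal X = (LEAST b. \<forall>x\<in>X. x \<le> b)"

instance
proof
  fix x z :: "'a ordinal" and X :: "'a ordinal set"
  show "Inf X \<le> x" if "x \<in> X"
    using that by (simp add: Inf_ordinal_def Least_le)
  show "z \<le> Inf X" if "X \<noteq> {}" "\<And>x. x \<in> X \<Longrightarrow> z \<le> x"
    using that by (metis Inf_ordinal_def LeastI ex_in_conv)
  show "x \<le> Sup X" if x: "x \<in> X" and bdd: "bdd_above X"
  proof -
    obtain b where "\<forall>x\<in>X. x \<le> b"
      using bdd by (auto simp: bdd_above_def)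
    from LeastI[of "\<lambda>b. \<forall>x\<in>X. x \<le> b", OF this] x show ?thesis
      by (simp add: Sup_ordinal_def)
  qed
  show "Sup X \<le> z" if "\<And>x. x \<in> X \<Longrightarrow> x \<le> z"
    using that by (simp add: Sup_ordinal_def Least_le)
qed (auto simp: inf_ordinal_def sup_ordinal_def)

end

definition ord_succ :: "'a ordinal \<Rightarrow> 'a ordinal" where
  "ord_succ x = (LEAST y. x < y)"

instantiation ordinal :: (type) "{zero, one}"
begin

definition zero_ordinal :: "'a ordinal" where
  "zero_ordinal = (LEAST x. True)"

definition one_ordinal :: "'a ordinal" where
  "one_ordinal = ord_succ 0"

instance ..

end

text \<open>
  Transfinite recursion with separate clauses for zero, successors and limits. The function
  passed to the limit clause is only meaningful below the limit.
\<close>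

definition ord_rec ::
  "'b \<Rightarrow> ('a ordinal \<Rightarrow> 'b \<Rightarrow> 'b) \<Rightarrow> ('a ordinal \<Rightarrow> ('a ordinal \<Rightarrow> 'b) \<Rightarrow> 'b) \<Rightarrow> 'a ordinal \<Rightarrow> 'b" where
  "ord_rec z s l = wfrec {(x, y). x < y} (\<lambda>f t.
     if t = 0 then z
     else if \<exists>u<t. t = ord_succ u then (let u = (THE u. u < t \<and> t = ord_succ u) in s u (f u))
     else l t f)"

lemma zero_ordinal_le: "(0 :: 'a ordinal) \<le> x"
  by (simp add: zero_ordinal_def Least_le)

lemma wf_less_ordinal: "wf {(x, y :: 'a ordinal). x < y}"
  by (rule wf)

lemma ord_rec_unfold:
  "ord_rec z s l t =
     (if t = 0 then z
      else if \<exists>u<t. t = ord_succ u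
        then (let u = (THE u. u < t \<and> t = ord_succ u)
              in s u (cut (ord_rec z s l) {(x, y). x < y} t u))
      else l t (cut (ord_rec z s l) {(x, y). x < y} t))"
  unfolding ord_rec_def by (rule wfrec[OF wf_less_ordinal])

lemma ord_rec_0: "ord_rec z s l 0 = z"
  by (simp add: ord_rec_unfold[of z s l 0])

lemma ord_rec_succ:
  assumes "u < ord_succ u"
  shows "ord_rec z s l (ord_succ u) = s u (ord_rec z s l u)"
proof -
  have "(THE v. v < ord_succ u \<and> ord_succ u = ord_succ v) = u"
  proof (rule the_equality)
    fix v assume v: "v < ord_succ u \<and> ord_succ u = ord_succ v"
    then have "\<not> u < v" "\<not> v < u"
      using not_less_Least[of v "\<lambda>y. u < y"] not_less_Least[of u "\<lambda>y. v < y"] assms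
      unfolding ord_succ_def by auto
    then show "v = u" by simp
  qed (use assms in simp)
  moreover have "ord_succ u \<noteq> 0"
    using assms zero_ordinal_le[of u] by auto
  moreover have "\<exists>v<ord_succ u. ord_succ u = ord_succ v"
    using assms by blast
  ultimately show ?thesis
    using assms by (subst ord_rec_unfold) (simp add: cut_apply)
qed

lemma ord_rec_limit:
  assumes "t \<noteq> 0" "\<nexists>u. u < t \<and> t = ord_succ u"
    and "\<And>f g. (\<And>s. s < t \<Longrightarrow> f s = g s) \<Longrightarrow> l t f = l t g"
  shows "ord_rec z s l t = l t (ord_rec z s l)"
proof -
  have "ord_rec z s l t = l t (cut (ord_rec z s l) {(x, y). x < y} t)"
    using assms(1,2) by (subst ord_rec_unfold) meson
  also have "\<dots> = l t (ord_rec z s l)"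
    by (rule assms(3)) (simp add: cut_apply)
  finally show ?thesis .
qed

definition ord_add :: "'a ordinal \<Rightarrow> 'a ordinal \<Rightarrow> 'a ordinal" where
  "ord_add \<beta> = ord_rec \<beta> (\<lambda>_. ord_succ) (\<lambda>\<eta> f. SUP \<delta>\<in>{..<\<eta>}. f \<delta>)"

definition ord_mult :: "'a ordinal \<Rightarrow> 'a ordinal \<Rightarrow> 'a ordinal" where
  "ord_mult \<beta> = ord_rec 0 (\<lambda>_ \<mu>. ord_add \<mu> \<beta>) (\<lambda>\<eta> f. SUP \<delta>\<in>{..<\<eta>}. f \<delta>)"

text \<open>The supremum at limits omits exponent \<open>0\<close>, so that \<open>0\<close> to any positive power is \<open>0\<close>.\<close>

definition ord_exp :: "'a ordinal \<Rightarrow> 'a ordinal \<Rightarrow> 'a ordinal" where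
  "ord_exp \<beta> = ord_rec 1 (\<lambda>_ \<mu>. ord_mult \<mu> \<beta>) (\<lambda>\<eta> f. SUP \<delta>\<in>{0<..<\<eta>}. f \<delta>)"

definition exponentially_closed :: "'a ordinal \<Rightarrow> bool" where
  "exponentially_closed \<alpha> \<longleftrightarrow>
     infinite {..<\<alpha>} \<and> (\<forall>\<beta><\<alpha>. \<forall>\<gamma><\<alpha>. ord_exp \<beta> \<gamma> < \<alpha>)"


section \<open>Register machines\<close>

datatype instr =
    Incr nat
  | Copy nat nat  \<comment> \<open>\<open>Copy i j\<close> copies register \<open>i\<close> to register \<open>j\<close>\<close>
  | JumpEq nat nat nat  \<comment> \<open>\<open>JumpEq i j k\<close> jumps to line \<open>k\<close> if registers \<open>i\<close> and \<open>j\<close> agree\<close>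
  | Oracle nat

type_synonym prog = "instr list"

text \<open>
  A configuration consists of the index of the active line and the register contents.
  A program only uses the finitely many registers that it mentions. The others keep their
  initial contents. The machine has halted when the active line is not a line of the program.
\<close>

type_synonym 'a config = "nat \<times> (nat \<Rightarrow> 'a ordinal)"

fun exec :: "'a ordinal set \<Rightarrow> instr \<Rightarrow> 'a config \<Rightarrow> 'a config" where
  "exec x (Incr i) (l, R) = (Suc l, R(i := ord_succ (R i)))"
| "exec x (Copy i j) (l, R) = (Suc l, R(j := R i))"
| "exec x (JumpEq i j k) (l, R) = (if R i = R j then k else Suc l, R)"
| "exec x (Oracle j) (l, R) = (Suc l, R(j := if R j \<in> x then 1 else 0))"

definition halted :: "prog \<Rightarrow> 'a config \<Rightarrow> bool" where
  "halted P c \<longleftrightarrow> length P \<le> fst c"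

definition step :: "prog \<Rightarrow> 'a ordinal set \<Rightarrow> 'a config \<Rightarrow> 'a config" where
  "step P x c = (if halted P c then c else exec x (P ! fst c) c)"

definition inferior_limit ::
  "'a ordinal \<Rightarrow> ('a ordinal \<Rightarrow> 'b::conditionally_complete_linorder) \<Rightarrow> 'b" where
  "inferior_limit t f = (SUP s\<in>{..<t}. INF r\<in>{s..<t}. f r)"

definition limit_config :: "'a ordinal \<Rightarrow> ('a ordinal \<Rightarrow> 'a config) \<Rightarrow> 'a config" where
  "limit_config t C =
     (inferior_limit t (\<lambda>s. fst (C s)), \<lambda>i. inferior_limit t (\<lambda>s. snd (C s) i))"

text \<open>
  The configuration at each time. The value \<open>None\<close> means that the computation is undefined
  because of an overflow at this time or earlier.
\<close>

definition run :: "'a ordinal \<Rightarrow> prog \<Rightarrow> 'a ordinal set \<Rightarrow> 'a ordinal list \<Rightarrow>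
    'a ordinal \<Rightarrow> 'a config option" where
  "run \<alpha> P x inputs = ord_rec
     (Some (0, \<lambda>i. if i < length inputs then inputs ! i else 0))
     (\<lambda>_. map_option (step P x))
     (\<lambda>t C. if \<exists>s<t. C s = None then None
            else let c = limit_config t (\<lambda>s. the (C s))
                 in if \<exists>i. snd c i = \<alpha> then None else Some c)"

definition halts_at :: "'a ordinal \<Rightarrow> prog \<Rightarrow> 'a ordinal set \<Rightarrow> 'a ordinal list \<Rightarrow>
    'a ordinal \<Rightarrow> 'a config \<Rightarrow> bool" where
  "halts_at \<alpha> P x inputs \<tau> c \<longleftrightarrow>
     run \<alpha> P x inputs \<tau> = Some c \<and> halted P c \<and>
     (\<forall>t<\<tau>. \<exists>d. run \<alpha> P x inputs t = Some d \<and> \<not> halted P d)"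

text \<open>Register \<open>0\<close> is both the first input register and the output register.\<close>

definition halts_with :: "'a ordinal \<Rightarrow> prog \<Rightarrow> 'a ordinal set \<Rightarrow> 'a ordinal list \<Rightarrow>
    'a ordinal \<Rightarrow> bool" where
  "halts_with \<alpha> P x inputs v \<longleftrightarrow> (\<exists>\<tau> c. halts_at \<alpha> P x inputs \<tau> c \<and> snd c 0 = v)"

text \<open>Computations without an oracle are computations with the empty oracle.\<close>

definition wITRM_computable :: "'a ordinal \<Rightarrow> 'a ordinal set \<Rightarrow> bool" where
  "wITRM_computable \<alpha> x \<longleftrightarrow> x \<subseteq> {..<\<alpha>} \<and>
     (\<exists>P. \<forall>\<iota><\<alpha>. halts_with \<alpha> P {} [\<iota>, 0] (if \<iota> \<in> x then 1 else 0))"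

definition wITRM_recognizable :: "'a ordinal \<Rightarrow> 'a ordinal set \<Rightarrow> bool" where
  "wITRM_recognizable \<alpha> x \<longleftrightarrow> x \<subseteq> {..<\<alpha>} \<and>
     (\<exists>P. \<forall>y\<subseteq>{..<\<alpha>}. halts_with \<alpha> P y [0] (if y = x then 1 else 0))"

definition wITRM_searchable :: "'a ordinal \<Rightarrow> bool" where
  "wITRM_searchable \<alpha> \<longleftrightarrow>
     (\<exists>P \<tau> c. halts_at \<alpha> P {} [0] \<tau> c \<and>
       (\<forall>\<iota><\<alpha>. \<exists>t<\<tau>. \<exists>d. run \<alpha> P {} [0] t = Some d \<and> snd d 0 = \<iota>))"

end

(*
(3) implies (4): a recognizer P for x must query every element of alpha in its computation with
oracle x, since changing x at an unqueried point would not change the output. If x is computable,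
the oracle calls can be replaced by a subroutine for x that reads the queried element from
register 0. The resulting machine needs no oracle, halts, and register 0 runs through alpha.
(4) implies (1): interleave a search with a comparison of the oracle with the program for x at the
current content of the first register of the search; stop with 0 at the first disagreement, and
with 1 when the search ends. The empty set is computable, which gives (1) => (2) => (3).

A simulated step becomes a block of l * B, ..., (l + 1) * B - 1 of program lines that is entered at
its first line, and during which no simulated register drops below both its old and its new value.
This makes inferior limits agree at limits of simulated times.
*)
theory Submission
  imports Defs
begin

section \<open>Ordinals\<close>

unbundle cardinal_syntax

text \<open>Auxiliary configurations between simulated steps could cause overflow at limits:
  register 0 is meant to run through all of \<alpha>. Scratch registers are therefore back at 0
  whenever a simulated step is complete, so their inferior limit at a limit of simulated times is 0.
  Simulated registers cannot overflow there because the simulated computation is defined. The reset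
  also gives each subroutine call fresh registers. The machine has neither constants nor an
  unconditional jump, so one further register \<open>Z\<close> is never written and supplies both.
  Stretching time needs a time axis that is closed under sums and under suprema of sequences indexed
  by an initial segment. The cardinality arguments at the start provide this for
  \<open>'a ordinal\<close>. Exponential closure enters by making \<alpha> a limit: overflow is
  tested only at limit times, so an increment must not be able to reach \<alpha>.\<close>

definition order_on :: "'a::wellorder set \<Rightarrow> 'a rel" where
  "order_on A = {(u, v). u \<in> A \<and> v \<in> A \<and> u \<le> v}"

lemma Field_order_on: "Field (order_on A) = A"
  by (auto simp: order_on_def Field_def)

lemma Well_order_order_on: "Well_order (order_on A)"
proof -
  have "wf (order_on A - Id)"
    by (rule wf_subset[OF wf]) (auto simp: order_on_def)
  then show ?thesis
    unfolding well_order_on_def linear_order_on_def partial_order_on_def preorder_on_def Field_order_on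
    by (auto simp: order_on_def refl_on_def trans_def antisym_def total_on_def)
qed

lemma abs_ordinal_less_iff:
  assumes "Well_order r" "Well_order s"
  shows "abs_ordinal r < abs_ordinal s \<longleftrightarrow> (r, s) \<in> ordLess"
  using assms by (intro less_ordinal.abs_eq) (simp_all add: ordIso_self_Well_order)

lemma ordinal_less_imp_segment:
  assumes "s < (t :: 'a ordinal)"
  shows "\<exists>a. (rep_ordinal s, Restr (rep_ordinal t) (underS (rep_ordinal t) a)) \<in> ordIso"
proof -
  have "(rep_ordinal s, rep_ordinal t) \<in> ordLess"
    using assms by (simp add: less_ordinal_def)
  moreover have "Well_order (rep_ordinal s)" "Well_order (rep_ordinal t)"
    using Quotient3_ordinal Quotient3_rep_reflp ordIso_self_Well_order by metis+
  ultimately show ?thesis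
    using ordLess_iff_ordIso_Restr by blast
qed

text \<open>Each \<open>s < t\<close> is the order type of an initial segment of a representative of
  \<open>t\<close>, cut off at a point of \<open>'a\<close>. The cut point determines the order
  type, which gives an injection into \<open>'a\<close>.\<close>

lemma card_of_lessThan_ordinal: "|{..<t :: 'a ordinal}| \<le>o |UNIV :: 'a set|"
proof -
  obtain a where a: "\<And>s. s < t \<Longrightarrow>
      (rep_ordinal s, Restr (rep_ordinal t) (underS (rep_ordinal t) (a s))) \<in> ordIso"
    using ordinal_less_imp_segment[of _ t] by metis
  have "inj_on a {..<t}"
  proof (rule inj_onI, simp)
    fix s u assume "s < t" "u < t" "a s = a u"
    then have "(rep_ordinal s, rep_ordinal u) \<in> ordIso"
      using a by (metis ordIso_symmetric ordIso_transitive)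
    then show "s = u"
      by (simp add: Quotient3_rel_rep[OF Quotient3_ordinal])
  qed
  then show ?thesis
    by (auto simp: card_of_ordLeq[symmetric])
qed

text \<open>Otherwise all ordinals would have an order type in the same type (Burali-Forti).\<close>

lemma not_card_of_ordinal_ordLeq: "\<not> |UNIV :: 'a ordinal set| \<le>o |UNIV :: 'a set|"
proof
  assume "|UNIV :: 'a ordinal set| \<le>o |UNIV :: 'a set|"
  then obtain g :: "'a ordinal \<Rightarrow> 'a" where g: "inj g"
    by (auto simp: card_of_ordLeq[symmetric])
  \<comment> \<open>\<open>g\<close> transports the order of any set of ordinals to
    \<open>'a\<close>, so even the order of all ordinals gets an order type in
    \<open>'a ordinal\<close>, and each \<open>r {..<x}\<close> is strictly shorter.\<close>
  define r where "r A = dir_image (order_on A) g" for A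
  have wo: "Well_order (r A)" for A
    unfolding r_def using Well_order_order_on g by (intro Well_order_dir_image) (auto intro: inj_on_subset)
  have r: "(g u, g v) \<in> r A \<longleftrightarrow> u \<in> A \<and> v \<in> A \<and> u \<le> v" for u v A
    using g by (auto simp: r_def dir_image_def order_on_def inj_eq)
  have r': "p \<in> r A \<Longrightarrow> \<exists>u v. p = (g u, g v)" for p A
    by (auto simp: r_def dir_image_def)
  have Fr: "Field (r A) = g ` A" for A
    by (simp add: r_def dir_image_Field Field_order_on)
  have seg: "(r {..<x}, r A) \<in> ordLess" if "{..x} \<subseteq> A" for x A
  proof -
    have "underS (r A) (g x) = g ` {..<x}"
    proof (intro equalityI subsetI)
      fix p assume "p \<in> underS (r A) (g x)"
      then have p: "p \<noteq> g x" "(p, g x) \<in> r A"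
        by (auto simp: underS_def)
      then obtain u where "p = g u" using r' by blast
      with p show "p \<in> g ` {..<x}"
        by (auto simp: r order.strict_iff_order)
    qed (use that g in \<open>auto simp: underS_def r inj_eq subset_iff\<close>)
    then have "r {..<x} = Restr (r A) (underS (r A) (g x))"
      using that r'[of _ "{..<x}"] r'[of _ A] by (fastforce simp: r)
    moreover have "g x \<in> Field (r A)"
      using that by (auto simp: Fr)
    ultimately show ?thesis
      using underS_Restr_ordLess[OF wo, of A] g Fr by fastforce
  qed
  define h where "h x = abs_ordinal (r {..<x})" for x
  have mono: "h x < h y" if "x < y" for x y
  proof -
    have "{..x} \<subseteq> {..<y}" using that by auto
    then show ?thesis
      unfolding h_def by (simp add: abs_ordinal_less_iff wo seg)
  qed
  have less: "h x < abs_ordinal (r UNIV)" for x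
    unfolding h_def by (subst abs_ordinal_less_iff) (use wo seg in auto)
  \<comment> \<open>A strictly increasing map on a well-order never falls below the identity. At the
    order type of \<open>r UNIV\<close> this contradicts \<open>less\<close>.\<close>
  have "x \<le> h x" for x
  proof (induction x rule: less_induct)
    case (less x)
    show ?case
      using less mono by (meson leI le_less_trans less_irrefl)
  qed
  then show False
    using less[of "abs_ordinal (r UNIV)"] by (auto simp: not_less[symmetric])
qed

unbundle no cardinal_syntax

lemma ord_succ_le: "x < y \<Longrightarrow> ord_succ x \<le> y"
  unfolding ord_succ_def by (rule Least_le)

lemma ordinal_limit_cases:
  obtains "t = 0" | u where "u < t" "t = ord_succ u"
  | "t \<noteq> 0" "\<nexists>u. u < t \<and> t = ord_succ u"
  by blast

lemma not_less_zero_ordinal: "\<not> x < (0 :: 'a ordinal)"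
  using zero_ordinal_le[of x] by (simp add: not_less)

lemma zero_less_ordinal: "0 < x \<longleftrightarrow> x \<noteq> (0 :: 'a ordinal)"
  using zero_ordinal_le[of x] by (auto simp: order.strict_iff_order)

definition is_limit :: "'a ordinal \<Rightarrow> bool" where
  "is_limit t \<longleftrightarrow> t \<noteq> 0 \<and> (\<forall>u<t. ord_succ u < t)"

lemma is_limitI: "t \<noteq> 0 \<Longrightarrow> \<nexists>u. u < t \<and> t = ord_succ u \<Longrightarrow> is_limit t"
  unfolding is_limit_def using ord_succ_le[of _ t] by (metis order.not_eq_order_implies_strict)

lemma strict_mono_ordinal_ge:
  assumes "\<And>x y. x < y \<Longrightarrow> f x < f y"
  shows "x \<le> (f x :: 'a ordinal)"
  by (induction x rule: less_induct) (use assms in \<open>meson leI le_less_trans less_irrefl\<close>)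

section \<open>Successors, suprema and arithmetic in the type of ordinals\<close>

locale infinite_ordinal =
  fixes \<alpha> :: "'a ordinal"
  assumes infinite_lessThan: "infinite {..<\<alpha>}"
begin

lemma infinite_UNIV_type: "infinite (UNIV :: 'a set)"
proof
  assume fin: "finite (UNIV :: 'a set)"
  have "finite {..<\<alpha>}"
    using card_of_ordLeq_finite[OF card_of_lessThan_ordinal fin] .
  with infinite_lessThan show False by simp
qed

text \<open>Below and including a greatest \<open>x\<close> there would be at most as many ordinals
  as elements of the infinite type \<open>'a\<close>. Hence the \<open>LEAST\<close> in
  \<open>ord_succ\<close> always denotes a genuine successor.\<close>

lemma exists_greater: "\<exists>y. x < (y :: 'a ordinal)"
proof (rule ccontr)
  assume "\<not> ?thesis"
  then have "(UNIV :: 'a ordinal set) = {..<x} \<union> {x}"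
    by (auto simp: not_less order.order_iff_strict)
  moreover have "(card_of ({..<x} \<union> {x}), card_of (UNIV :: 'a set)) \<in> ordLeq"
    using infinite_UNIV_type card_of_lessThan_ordinal[of x]
    by (intro card_of_Un_ordLeq_infinite_Field) (auto simp: Field_card_of intro: card_of_singl_ordLeq card_of_card_order_on)
  ultimately show False
    using not_card_of_ordinal_ordLeq by metis
qed

lemma less_ord_succ: "x < ord_succ (x :: 'a ordinal)"
  unfolding ord_succ_def using exists_greater by (rule LeastI_ex)

lemma less_ord_succ_iff: "x < ord_succ y \<longleftrightarrow> x \<le> (y :: 'a ordinal)"
  using less_ord_succ[of y] ord_succ_le[of y x] by (meson leD leI le_less_trans)

text \<open>This is regularity: an unbounded image would cover all ordinals by at most
  \<open>|'a|\<close> initial segments, each of size at most \<open>|'a|\<close>. The suprema in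
  limit clauses are thereby least upper bounds and not default values.\<close>

lemma bdd_above_ordinal_image:
  fixes f :: "'a ordinal \<Rightarrow> 'a ordinal"
  shows "bdd_above (f ` {..<t})"
proof (rule ccontr)
  assume "\<not> ?thesis"
  then have "(UNIV :: 'a ordinal set) = (\<Union>s\<in>{..<t}. {..<f s})"
    unfolding bdd_above_def by (auto simp: not_le)
  moreover have "(card_of (\<Union>s\<in>{..<t}. {..<f s}), card_of (UNIV :: 'a set)) \<in> ordLeq"
    using infinite_UNIV_type card_of_lessThan_ordinal
    by (intro card_of_UNION_ordLeq_infinite) auto
  ultimately show False
    using not_card_of_ordinal_ordLeq by metis
qed

lemma is_limit_succ: "\<not> is_limit (ord_succ (t :: 'a ordinal))"
  unfolding is_limit_def using less_ord_succ by blast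

lemma ordinal_induct [case_names zero succ limit]:
  fixes t :: "'a ordinal"
  assumes "P 0" "\<And>t. P t \<Longrightarrow> P (ord_succ t)"
    and "\<And>t. is_limit t \<Longrightarrow> (\<And>s. s < t \<Longrightarrow> P s) \<Longrightarrow> P t"
  shows "P t"
proof (induction t rule: less_induct)
  case (less t)
  show ?case
    using assms less is_limitI by (cases t rule: ordinal_limit_cases) auto
qed

text \<open>Besides sums and products, the time map \<open>\<theta>\<close> of a simulation has this
  form; its monotonicity and continuity come from here.\<close>

context
  fixes z :: "'a ordinal" and s and f :: "'a ordinal \<Rightarrow> 'a ordinal"
  assumes f_def: "f = ord_rec z s (\<lambda>\<eta> f. SUP \<delta>\<in>{..<\<eta>}. f \<delta>)"
begin

lemma normal_zero: "f 0 = z"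
  by (simp add: f_def ord_rec_0)

lemma normal_succ: "f (ord_succ u) = s u (f u)"
  by (simp add: f_def ord_rec_succ less_ord_succ)

lemma normal_limit: "is_limit t \<Longrightarrow> f t = (SUP u\<in>{..<t}. f u)"
  unfolding f_def
  by (rule ord_rec_limit) (auto simp: is_limit_def intro!: arg_cong[where f = Sup])

lemma normal_less:
  assumes "\<And>u m. m < s u m" "x < y"
  shows "f x < f y"
  using assms(2)
proof (induction y arbitrary: x rule: ordinal_induct)
  case zero
  then show ?case by (simp add: not_less_zero_ordinal)
next
  case (succ t)
  then have "f x \<le> f t"
    by (auto simp: less_ord_succ_iff order.order_iff_strict)
  then show ?case
    using assms(1) by (simp add: normal_succ le_less_trans)
next
  case (limit t)
  have "ord_succ x < t" "x < ord_succ x"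
    using limit(1,3) less_ord_succ by (auto simp: is_limit_def)
  then have "f x < f (ord_succ x)" "f (ord_succ x) \<le> f t"
    using limit(2) by (auto simp: normal_limit[OF limit(1)] intro!: cSUP_upper bdd_above_ordinal_image)
  then show ?case by simp
qed

lemma normal_less_limit:
  assumes "is_limit t" "v < f t"
  obtains u where "u < t" "v < f u"
proof -
  have "{..<t} \<noteq> {}" using assms(1) by (auto simp: is_limit_def zero_less_ordinal[symmetric])
  then show ?thesis
    using that assms(2) unfolding normal_limit[OF assms(1)]
    by (subst (asm) less_cSUP_iff) (auto intro: bdd_above_ordinal_image)
qed

end

lemmas ord_add_zero = normal_zero[OF ord_add_def]
  and ord_add_succ = normal_succ[OF ord_add_def]
  and ord_add_less = normal_less[OF ord_add_def less_ord_succ]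
  and less_ord_add_limit = normal_less_limit[OF ord_add_def]

lemma ord_add_less_iff: "ord_add x y < ord_add x z \<longleftrightarrow> y < (z :: 'a ordinal)"
  using ord_add_less[of y z x] ord_add_less[of z y x] by (metis less_asym linorder_neqE)

lemma ord_add_le_iff: "ord_add x y \<le> ord_add x z \<longleftrightarrow> y \<le> (z :: 'a ordinal)"
  by (simp add: ord_add_less_iff not_less[symmetric])

lemma le_ord_add: "x \<le> ord_add x (y :: 'a ordinal)"
  using ord_add_le_iff[of x 0 y] by (simp add: ord_add_zero zero_ordinal_le)

lemma less_ord_add: "0 < y \<Longrightarrow> x < ord_add x (y :: 'a ordinal)"
  using ord_add_less[of 0 y x] by (simp add: ord_add_zero)

lemma is_limit_ord_add: "is_limit t \<Longrightarrow> is_limit (ord_add x (t :: 'a ordinal))"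
  using less_ord_succ[of 0] ord_succ_le
  by (smt (verit, ccfv_threshold) is_limit_def le_less_trans less_ord_add_limit ord_add_less
      not_less_zero_ordinal zero_less_ordinal)

text \<open>Left subtraction. The least \<open>d\<close> with \<open>y \<le> ord_add x d\<close>
  cannot overshoot: not at 0 by assumption, not at a successor by minimality, not at a limit by
  continuity.\<close>

lemma le_imp_ord_add:
  assumes "x \<le> (y :: 'a ordinal)"
  obtains d where "y = ord_add x d"
proof -
  define d where "d = (LEAST d. y \<le> ord_add x d)"
  have "y \<le> ord_add x y"
    using strict_mono_ordinal_ge ord_add_less by blast
  then have d: "y \<le> ord_add x d"
    unfolding d_def by (rule LeastI)
  have less: "ord_add x u < y" if "u < d" for u
    using not_less_Least[OF that[unfolded d_def]] by simp
  have "ord_add x d \<le> y"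
  proof (cases d rule: ordinal_limit_cases)
    case 1
    then show ?thesis using assms by (simp add: ord_add_zero)
  next
    case (2 u)
    then show ?thesis using less[of u] ord_succ_le by (simp add: ord_add_succ)
  next
    case 3
    then show ?thesis
      using less by (metis is_limitI leI less_asym less_ord_add_limit)
  qed
  with d that show ?thesis by force
qed

lemmas ord_mult_zero = normal_zero[OF ord_mult_def]
  and ord_mult_succ = normal_succ[OF ord_mult_def]

lemma ord_mult_less: "0 < x \<Longrightarrow> y < z \<Longrightarrow> ord_mult x y < ord_mult x (z :: 'a ordinal)"
  by (rule normal_less[OF ord_mult_def]) (rule less_ord_add)

text \<open>If \<alpha> were the successor of \<open>\<mu>\<close>, infinity of \<alpha> would give
  \<open>2 \<le> \<mu>\<close>, and the square of \<open>\<mu>\<close> would exceed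
  \<open>\<mu>\<close>, the largest element below \<alpha>.\<close>

lemma exponentially_closed_ord_succ:
  assumes "exponentially_closed \<alpha>" "\<mu> < \<alpha>"
  shows "ord_succ \<mu> < \<alpha>"
proof (rule ccontr)
  assume "\<not> ?thesis"
  then have \<alpha>: "\<alpha> = ord_succ \<mu>"
    using ord_succ_le[OF assms(2)] by simp
  have two: "ord_succ 1 \<le> \<mu>"
  proof (rule ccontr)
    assume "\<not> ?thesis"
    then have "\<mu> \<le> 1"
      by (simp add: not_le less_ord_succ_iff)
    have "y \<in> {0, 1}" if "y < \<alpha>" for y
    proof (cases "y = 0")
      case False
      then have "1 \<le> y"
        by (simp add: one_ordinal_def ord_succ_le zero_less_ordinal)
      moreover have "y \<le> 1"
        using that \<open>\<mu> \<le> 1\<close> by (simp add: \<alpha> less_ord_succ_iff)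
      ultimately show ?thesis by simp
    qed simp
    then have "{..<\<alpha>} \<subseteq> {0, 1}" by auto
    with infinite_lessThan show False
      by (auto dest: finite_subset)
  qed
  have \<mu>: "0 < \<mu>" "1 < \<mu>"
    using two less_ord_succ[of "1 :: 'a ordinal"] zero_ordinal_le[of "1 :: 'a ordinal"] by auto
  have exp: "ord_exp \<mu> (ord_succ u) = ord_mult (ord_exp \<mu> u) \<mu>" for u
    unfolding ord_exp_def by (simp add: ord_rec_succ less_ord_succ)
  \<comment> \<open>\<open>X\<close> is the first power of \<open>\<mu>\<close>. The estimate
    \<open>\<mu> \<le> X\<close> suffices, so no identity law for products has to be proved.\<close>
  define X where "X = ord_mult 1 \<mu>"
  have "\<mu> \<le> X"
    unfolding X_def using less_ord_succ[of "0 :: 'a ordinal"]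
    by (intro strict_mono_ordinal_ge) (simp add: ord_mult_less one_ordinal_def)
  have "X \<le> ord_add 0 X"
    by (intro strict_mono_ordinal_ge) (simp add: ord_add_less_iff)
  also have "\<dots> = ord_mult X 1"
    by (simp add: one_ordinal_def ord_mult_succ ord_mult_zero)
  also have "ord_mult X 1 < ord_mult X \<mu>"
    using \<mu> \<open>\<mu> \<le> X\<close> by (intro ord_mult_less) auto
  also have "ord_mult X \<mu> = ord_exp \<mu> (ord_succ 1)"
    by (simp add: exp X_def one_ordinal_def) (simp add: ord_exp_def ord_rec_0 one_ordinal_def)
  finally have "\<mu> < ord_exp \<mu> (ord_succ 1)"
    using \<open>\<mu> \<le> X\<close> by simp
  moreover have "ord_succ 1 < \<alpha>"
    using two assms(2) by simp
  then have "ord_exp \<mu> (ord_succ 1) < \<alpha>"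
    using assms by (auto simp: exponentially_closed_def)
  ultimately show False
    by (simp add: \<alpha> less_ord_succ_iff not_less[symmetric])
qed

end

section \<open>Inferior limits\<close>

text \<open>A form of the inferior limit without \<open>SUP\<close> and \<open>INF\<close>. It
  serves line indices and register contents alike and moves between time scales without boundedness
  conditions.\<close>

definition liminf_at :: "'a ordinal \<Rightarrow> ('a ordinal \<Rightarrow> 'b::linorder) \<Rightarrow> 'b \<Rightarrow> bool" where
  "liminf_at t f L \<longleftrightarrow> (\<forall>m<L. \<exists>s<t. \<forall>r. s \<le> r \<longrightarrow> r < t \<longrightarrow> m < f r) \<and>
     (\<forall>s<t. \<exists>r. s \<le> r \<and> r < t \<and> f r \<le> L)"

lemma liminf_at_cong: "(\<And>s. s < t \<Longrightarrow> f s = g s) \<Longrightarrow> liminf_at t f L \<longleftrightarrow> liminf_at t g L"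
  unfolding liminf_at_def by (intro conj_cong) metis+

lemma liminf_at_const: "t \<noteq> 0 \<Longrightarrow> liminf_at t (\<lambda>_. c) c"
  unfolding liminf_at_def by (auto simp: zero_less_ordinal[symmetric])

text \<open>On the naturals an inferior limit is eventually a lower bound, because its predecessor
  is eventually exceeded. A monotone map preserves this even if it is not injective, as with line
  encodings that merge all halting lines.\<close>

lemma liminf_at_mono:
  fixes a :: "nat \<Rightarrow> nat"
  assumes "liminf_at t f L" "mono a" "t \<noteq> 0"
  shows "liminf_at t (\<lambda>s. a (f s)) (a L)"
  unfolding liminf_at_def
proof (intro conjI allI impI)
  fix m assume m: "m < a L"
  have "\<exists>s<t. \<forall>r. s \<le> r \<longrightarrow> r < t \<longrightarrow> L \<le> f r"
  proof (cases L)
    case 0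
    then show ?thesis using assms(3) by (auto simp: zero_less_ordinal[symmetric])
  next
    case (Suc k)
    then have "\<exists>s<t. \<forall>r. s \<le> r \<longrightarrow> r < t \<longrightarrow> k < f r"
      using assms(1) unfolding liminf_at_def by blast
    then show ?thesis using Suc by (auto simp: Suc_le_eq)
  qed
  then show "\<exists>s<t. \<forall>r. s \<le> r \<longrightarrow> r < t \<longrightarrow> m < a (f r)"
    using monoD[OF assms(2), of L] m by (metis less_le_trans)
next
  fix s assume "s < t"
  then obtain r where "s \<le> r" "r < t" "f r \<le> L"
    using assms(1) unfolding liminf_at_def by blast
  then show "\<exists>r. s \<le> r \<and> r < t \<and> a (f r) \<le> a L"
    using assms(2) by (auto dest: monoD)
qed

lemma INF_attained:
  fixes f :: "'c \<Rightarrow> 'b::{wellorder, conditionally_complete_linorder}"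
  assumes "A \<noteq> {}"
  obtains a where "a \<in> A" "(INF x\<in>A. f x) = f a"
proof -
  define m where "m = (LEAST y. y \<in> f ` A)"
  have "m \<in> f ` A"
    unfolding m_def using assms by (metis LeastI image_eqI ex_in_conv)
  moreover have "m \<le> y" if "y \<in> f ` A" for y
    unfolding m_def using that by (rule Least_le)
  ultimately have "(INF x\<in>A. f x) = m"
    by (rule cInf_eq_minimum)
  with \<open>m \<in> f ` A\<close> that show ?thesis by blast
qed

lemma bdd_below_wellorder: "bdd_below (A :: 'b::wellorder set)"
  by (meson bdd_belowI Least_le)

text \<open>The inner infima are attained in a well-order; the bound \<open>K\<close> makes the
  outer supremum a genuine one.\<close>

lemma liminf_at_inferior_limit:
  fixes f :: "'a ordinal \<Rightarrow> 'b::{wellorder, conditionally_complete_linorder}"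
  assumes "t \<noteq> 0" and bound: "\<And>s. s < t \<Longrightarrow> f s \<le> K"
  shows "liminf_at t f (inferior_limit t f)"
proof -
  define I where "I s = (INF r\<in>{s..<t}. f r)" for s
  have I: "\<exists>r. s \<le> r \<and> r < t \<and> I s = f r" if "s < t" for s
    using that INF_attained[of "{s..<t}" f] unfolding I_def
    by (metis atLeastLessThan_iff empty_iff order.refl)
  have I_le: "I s \<le> f r" if "s \<le> r" "r < t" for s r
    unfolding I_def using that by (intro cINF_lower bdd_below_wellorder) auto
  have bdd: "bdd_above (I ` {..<t})"
    using I bound by (intro bdd_aboveI2[of _ _ K]) (metis lessThan_iff)
  have ne: "{..<t} \<noteq> {}"
    using assms(1) by (auto simp: zero_less_ordinal[symmetric])
  show ?thesis
    unfolding liminf_at_def inferior_limit_def I_def[symmetric]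
  proof (intro conjI allI impI)
    fix m assume "m < (SUP s\<in>{..<t}. I s)"
    then obtain s where "s < t" "m < I s"
      using less_cSUP_iff[OF ne bdd] by auto
    then show "\<exists>s<t. \<forall>r. s \<le> r \<longrightarrow> r < t \<longrightarrow> m < f r"
      using I_le by (meson less_le_trans)
  next
    fix s assume s: "s < t"
    then have "I s \<le> (SUP s\<in>{..<t}. I s)"
      using bdd by (intro cSUP_upper) auto
    then show "\<exists>r. s \<le> r \<and> r < t \<and> f r \<le> (SUP s\<in>{..<t}. I s)"
      using I[OF s] by metis
  qed
qed

lemma inferior_limit_eqI:
  fixes f :: "'a ordinal \<Rightarrow> 'b::{wellorder, conditionally_complete_linorder}"
  assumes "t \<noteq> 0" "liminf_at t f L"
  shows "inferior_limit t f = L"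
proof -
  define I where "I s = (INF r\<in>{s..<t}. f r)" for s
  have I: "\<exists>r. s \<le> r \<and> r < t \<and> I s = f r" if "s < t" for s
    using that INF_attained[of "{s..<t}" f] unfolding I_def
    by (metis atLeastLessThan_iff empty_iff order.refl)
  have I_le: "I s \<le> f r" if "s \<le> r" "r < t" for s r
    unfolding I_def using that by (intro cINF_lower bdd_below_wellorder) auto
  have upper: "I s \<le> L" if "s < t" for s
    using assms(2) that I_le unfolding liminf_at_def by (meson order.trans)
  then have bdd: "bdd_above (I ` {..<t})"
    by (intro bdd_aboveI2[of _ _ L]) auto
  have ne: "{..<t} \<noteq> {}"
    using assms(1) by (auto simp: zero_less_ordinal[symmetric])
  have "L \<le> (SUP s\<in>{..<t}. I s)"
  proof (rule ccontr)
    assume "\<not> ?thesis"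
    then obtain s where s: "s < t" "\<And>r. s \<le> r \<Longrightarrow> r < t \<Longrightarrow> (SUP s\<in>{..<t}. I s) < f r"
      using assms(2) unfolding liminf_at_def by (meson not_le)
    then have "(SUP s\<in>{..<t}. I s) < I s"
      using I by metis
    then show False
      using bdd s(1) by (meson cSUP_upper lessThan_iff leD)
  qed
  moreover have "(SUP s\<in>{..<t}. I s) \<le> L"
    using upper ne by (intro cSUP_least) auto
  ultimately show ?thesis
    by (simp add: inferior_limit_def I_def)
qed

text \<open>This is \<open>run\<close> with an arbitrary initial configuration, so that computations
  can be restarted at any time and concatenated.\<close>

definition computation ::
    "'a ordinal \<Rightarrow> prog \<Rightarrow> 'a ordinal set \<Rightarrow> 'a config \<Rightarrow> 'a ordinal \<Rightarrow> 'a config option" where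
  "computation \<alpha> P x c = ord_rec (Some c)
     (\<lambda>_. map_option (step P x))
     (\<lambda>t C. if \<exists>s<t. C s = None then None
            else let c = limit_config t (\<lambda>s. the (C s))
                 in if \<exists>i. snd c i = \<alpha> then None else Some c)"

lemma run_eq_computation:
  "run \<alpha> P x inputs = computation \<alpha> P x (0, \<lambda>i. if i < length inputs then inputs ! i else 0)"
  by (simp add: run_def computation_def)

section \<open>Definedness, limits and concatenation of computations\<close>

locale register_machine = infinite_ordinal +
  assumes ord_succ_less: "x < \<alpha> \<Longrightarrow> ord_succ x < \<alpha>"
begin

lemma zero_less: "0 < \<alpha>"
proof -
  have "{..<0 :: 'a ordinal} = {}" by (auto simp: not_less_zero_ordinal)
  with infinite_lessThan show ?thesis
    by (auto simp: zero_less_ordinal)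
qed

lemma one_less: "1 < \<alpha>"
  unfolding one_ordinal_def by (intro ord_succ_less zero_less)

lemma zero_less_one: "(0 :: 'a ordinal) < 1"
  unfolding one_ordinal_def by (rule less_ord_succ)

abbreviation comp where "comp \<equiv> computation \<alpha>"

lemma comp_zero: "comp P x c 0 = Some c"
  by (simp add: computation_def ord_rec_0)

lemma comp_succ: "comp P x c (ord_succ t) = map_option (step P x) (comp P x c t)"
  by (simp add: computation_def ord_rec_succ less_ord_succ)

lemma comp_limit:
  assumes "is_limit t"
  shows "comp P x c t = (if \<exists>s<t. comp P x c s = None then None
    else let d = limit_config t (\<lambda>s. the (comp P x c s))
         in if \<exists>i. snd d i = \<alpha> then None else Some d)"
  unfolding computation_def
proof (rule ord_rec_limit)
  fix f g :: "'a ordinal \<Rightarrow> 'a config option"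
  assume fg: "\<And>s. s < t \<Longrightarrow> f s = g s"
  then have "(\<exists>s<t. f s = None) \<longleftrightarrow> (\<exists>s<t. g s = None)"
    by auto
  moreover have "limit_config t (\<lambda>s. the (f s)) = limit_config t (\<lambda>s. the (g s))"
    unfolding limit_config_def inferior_limit_def
    by (intro arg_cong2[where f = Pair] ext arg_cong[where f = Sup] image_cong refl arg_cong[where f = Inf])
      (simp_all add: fg)
  ultimately show "(if \<exists>s<t. f s = None then None
      else let d = limit_config t (\<lambda>s. the (f s)) in if \<exists>i. snd d i = \<alpha> then None else Some d) =
    (if \<exists>s<t. g s = None then None
      else let d = limit_config t (\<lambda>s. the (g s)) in if \<exists>i. snd d i = \<alpha> then None else Some d)"
    by (simp only:)
qed (use assms is_limit_succ in \<open>auto simp: is_limit_def\<close>)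

lemma comp_defined_le:
  assumes "comp P x c t = Some d" "s \<le> t"
  shows "\<exists>e. comp P x c s = Some e"
  using assms
proof (induction t arbitrary: d rule: ordinal_induct)
  case zero
  then show ?case using zero_ordinal_le[of s] by (metis antisym)
next
  case (succ t)
  then show ?case
    by (cases "s = ord_succ t") (auto simp: comp_succ order.order_iff_strict less_ord_succ_iff)
next
  case (limit t)
  then show ?case
    by (cases "s = t") (auto simp: comp_limit order.order_iff_strict split: if_splits)
qed

definition good :: "'a config \<Rightarrow> bool" where
  "good c \<longleftrightarrow> (\<forall>i. snd c i < \<alpha>)"

lemma good_step: "good c \<Longrightarrow> good (step P x c)"
  using zero_less one_less ord_succ_less
  by (cases c; cases "P ! fst c") (auto simp: step_def good_def)

definition jump_target :: "instr \<Rightarrow> nat" where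
  "jump_target i = (case i of JumpEq _ _ k \<Rightarrow> k | _ \<Rightarrow> 0)"

text \<open>The sum of all jump targets crudely dominates each of them. A bound on line indices is
  needed to control the supremum in their inferior limit.\<close>

definition line_bound :: "prog \<Rightarrow> nat" where
  "line_bound P = length P + (\<Sum>i\<in>set P. jump_target i)"

lemma step_le_line_bound:
  assumes "fst c \<le> l" "line_bound P \<le> l"
  shows "fst (step P x c) \<le> l"
proof (cases "halted P c")
  case False
  then have "P ! fst c \<in> set P" by (simp add: halted_def)
  then have "jump_target (P ! fst c) \<le> line_bound P"
    unfolding line_bound_def by (intro trans_le_add2 member_le_sum) auto
  moreover have "Suc (fst c) \<le> line_bound P"
    using False by (simp add: halted_def line_bound_def)
  ultimately show ?thesis
    using False assms
    by (cases c; cases "P ! fst c") (auto simp: step_def jump_target_def)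
qed (use assms in \<open>simp add: step_def\<close>)

lemma liminf_at_le:
  assumes "liminf_at t f L" "t \<noteq> 0" "\<And>s. s < t \<Longrightarrow> f s \<le> K"
  shows "L \<le> K"
proof (rule ccontr)
  assume "\<not> ?thesis"
  then obtain s where "s < t" "\<forall>r. s \<le> r \<longrightarrow> r < t \<longrightarrow> K < f r"
    using assms(1) unfolding liminf_at_def by (meson not_le)
  then show False using assms(3) by (meson leD order.refl)
qed

lemma comp_limit_liminf:
  assumes "is_limit t" "\<And>s. s < t \<Longrightarrow> comp P x c s = Some (C s)"
    and "\<And>s. s < t \<Longrightarrow> good (C s) \<and> fst (C s) \<le> K"
    and "comp P x c t = Some d"
  shows "liminf_at t (\<lambda>s. fst (C s)) (fst d)" "liminf_at t (\<lambda>s. snd (C s) i) (snd d i)" "snd d i < \<alpha>"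
proof -
  have t: "t \<noteq> 0" using assms(1) by (simp add: is_limit_def)
  have d: "d = limit_config t (\<lambda>s. the (comp P x c s))" "snd d i \<noteq> \<alpha>"
    using assms(2,4) by (auto simp: comp_limit[OF assms(1)] Let_def split: if_splits)
  have "liminf_at t (\<lambda>s. fst (the (comp P x c s))) (fst d)"
    unfolding d(1) limit_config_def fst_conv
    using assms(2,3) by (intro liminf_at_inferior_limit[OF t, of _ K]) auto
  then show "liminf_at t (\<lambda>s. fst (C s)) (fst d)"
    using assms(2) by (simp cong: liminf_at_cong)
  have le: "snd (C s) i \<le> \<alpha>" if "s < t" for s
    using assms(3)[OF that] by (simp add: good_def less_imp_le)
  have "liminf_at t (\<lambda>s. snd (the (comp P x c s)) i) (snd d i)"
    unfolding d(1) limit_config_def snd_conv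
    using assms(2) le by (intro liminf_at_inferior_limit[OF t, of _ \<alpha>]) auto
  then show lim: "liminf_at t (\<lambda>s. snd (C s) i) (snd d i)"
    using assms(2) by (simp cong: liminf_at_cong)
  show "snd d i < \<alpha>"
    using liminf_at_le[OF lim t le] d(2) by simp
qed

lemma comp_good_bounded:
  assumes "good c" "comp P x c t = Some d"
  shows "good d \<and> fst d \<le> fst c + line_bound P"
  using assms(2)
proof (induction t arbitrary: d rule: ordinal_induct)
  case zero
  then show ?case using assms by (simp add: comp_zero)
next
  case (succ t)
  then show ?case
    by (auto simp: comp_succ intro: good_step step_le_line_bound)
next
  case (limit t)
  have t: "t \<noteq> 0" using limit(1) by (simp add: is_limit_def)
  have C: "comp P x c s = Some (the (comp P x c s))" if "s < t" for s
    using comp_defined_le[OF limit(3), of s] that by auto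
  note lim = comp_limit_liminf[OF limit(1) C limit(2)[OF _ C] limit(3)]
  show ?case
    using lim(3) liminf_at_le[OF lim(1) t] limit(2)[OF _ C] by (auto simp: good_def)
qed

lemmas comp_good = comp_good_bounded[THEN conjunct1]

definition limit_of :: "'a ordinal \<Rightarrow> ('a ordinal \<Rightarrow> 'a config) \<Rightarrow> 'a config \<Rightarrow> bool" where
  "limit_of t C d \<longleftrightarrow> liminf_at t (\<lambda>s. fst (C s)) (fst d) \<and>
     (\<forall>i. liminf_at t (\<lambda>s. snd (C s) i) (snd d i) \<and> snd d i < \<alpha>)"

lemma limit_of_cong: "(\<And>s. s < t \<Longrightarrow> C s = C' s) \<Longrightarrow> limit_of t C d \<longleftrightarrow> limit_of t C' d"
  unfolding limit_of_def by (simp cong: liminf_at_cong)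

text \<open>Definedness is included: the condition \<open>snd d i < \<alpha>\<close> in
  \<open>limit_of\<close> is the absence of overflow, so exhibiting a limit configuration also shows
  that the computation continues.\<close>

lemma comp_limit_iff:
  assumes "good c" "is_limit t" "\<And>s. s < t \<Longrightarrow> comp P x c s = Some (C s)"
  shows "comp P x c t = Some d \<longleftrightarrow> limit_of t C d"
proof
  show "limit_of t C d" if "comp P x c t = Some d"
    using comp_limit_liminf[OF assms(2,3) comp_good_bounded[OF assms(1) assms(3)] that]
    by (simp add: limit_of_def)
next
  assume R: "limit_of t C d"
  have t: "t \<noteq> 0" using assms(2) by (simp add: is_limit_def)
  have "limit_config t (\<lambda>s. the (comp P x c s)) = d"
    unfolding limit_config_def
  proof (rule prod_eqI; simp; (rule ext)?)
    show "inferior_limit t (\<lambda>s. fst (the (comp P x c s))) = fst d"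
      using R assms(3) unfolding limit_of_def by (intro inferior_limit_eqI[OF t]) (simp cong: liminf_at_cong)
    show "inferior_limit t (\<lambda>s. snd (the (comp P x c s)) i) = snd d i" for i
      using R assms(3) unfolding limit_of_def by (intro inferior_limit_eqI[OF t]) (simp cong: liminf_at_cong)
  qed
  then show "comp P x c t = Some d"
    using R assms(3) by (auto simp: comp_limit[OF assms(2)] Let_def limit_of_def) (metis less_irrefl)
qed

lemma liminf_at_shift:
  fixes t :: "'a ordinal"
  assumes "is_limit t"
  shows "liminf_at (ord_add s t) f L \<longleftrightarrow> liminf_at t (\<lambda>u. f (ord_add s u)) (L :: 'b::linorder)"
    (is "?L \<longleftrightarrow> ?R")
proof -
  have t: "0 < t" using assms by (simp add: is_limit_def zero_less_ordinal)
  have 1: "(\<exists>a<ord_add s t. \<forall>r. a \<le> r \<longrightarrow> r < ord_add s t \<longrightarrow> Q r) \<longleftrightarrow>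
      (\<exists>a<t. \<forall>r. a \<le> r \<longrightarrow> r < t \<longrightarrow> Q (ord_add s r))" (is "?A \<longleftrightarrow> ?B") for Q
  proof
    assume ?A
    then obtain a where a: "a < ord_add s t" "\<And>r. a \<le> r \<Longrightarrow> r < ord_add s t \<Longrightarrow> Q r"
      by blast
    then obtain b where b: "b < t" "a < ord_add s b"
      using less_ord_add_limit[OF assms] by blast
    then have "Q (ord_add s r)" if "b \<le> r" "r < t" for r
      using that a(2) by (meson less_imp_le less_le_trans ord_add_le_iff ord_add_less_iff)
    with b show ?B by blast
  next
    assume ?B
    then obtain a where a: "a < t" "\<And>r. a \<le> r \<Longrightarrow> r < t \<Longrightarrow> Q (ord_add s r)"
      by blast
    have "Q r" if r: "ord_add s a \<le> r" "r < ord_add s t" for r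
    proof -
      have "s \<le> r" using r(1) le_ord_add order.trans by blast
      then obtain d where "r = ord_add s d" by (rule le_imp_ord_add)
      then show ?thesis using r a(2) by (simp add: ord_add_le_iff ord_add_less_iff)
    qed
    with a show ?A using ord_add_less_iff by blast
  qed
  have 2: "(\<forall>a<u. \<exists>r. a \<le> r \<and> r < u \<and> Q r) \<longleftrightarrow> \<not> (\<exists>a<u. \<forall>r. a \<le> r \<longrightarrow> r < u \<longrightarrow> \<not> Q r)"
    for u :: "'a ordinal" and Q
    by blast
  show ?thesis
    unfolding liminf_at_def 2 1 by (rule refl)
qed

text \<open>The next configuration depends only on the present one, and an inferior limit only on a
  final part of the times. The equation also covers undefined values on both sides.\<close>

lemma comp_add:
  assumes "good c" "comp P x c s = Some d"
  shows "comp P x c (ord_add s t) = comp P x d t"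
proof (induction t rule: ordinal_induct)
  case (limit t)
  note d = comp_good[OF assms]
  have lt: "ord_add s u < ord_add s t" if "u < t" for u
    using that by (simp add: ord_add_less_iff)
  show ?case
  proof (cases "\<exists>u<t. comp P x d u = None")
    case True
    then obtain u where u: "u < t" "comp P x d u = None" by blast
    then have "comp P x c (ord_add s u) = None" using limit by simp
    with u show ?thesis
      using comp_defined_le lt by (metis not_None_eq less_imp_le option.distinct(1))
  next
    case False
    then have C: "comp P x d u = Some (the (comp P x d u))" if "u < t" for u
      using that by auto
    have C': "comp P x c v = Some (the (comp P x c v))" if v: "v < ord_add s t" for v
    proof -
      obtain u where "u < t" "v < ord_add s u"
        using less_ord_add_limit[OF limit(1) v] by blast
      then show ?thesis
        using comp_defined_le[of P x c "ord_add s u" _ v] C limit(2) by fastforce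
    qed
    have "comp P x c (ord_add s t) = Some e \<longleftrightarrow> comp P x d t = Some e" for e
    proof -
      have "comp P x c (ord_add s t) = Some e \<longleftrightarrow> limit_of (ord_add s t) (\<lambda>v. the (comp P x c v)) e"
        by (rule comp_limit_iff[OF assms(1) is_limit_ord_add[OF limit(1)] C'])
      also have "\<dots> \<longleftrightarrow> limit_of t (\<lambda>u. the (comp P x c (ord_add s u))) e"
        by (simp add: limit_of_def liminf_at_shift[OF limit(1)])
      also have "\<dots> \<longleftrightarrow> limit_of t (\<lambda>u. the (comp P x d u)) e"
        using limit(2) by (intro limit_of_cong) simp
      also have "\<dots> \<longleftrightarrow> comp P x d t = Some e"
        by (rule comp_limit_iff[OF d limit(1) C, symmetric])
      finally show ?thesis .
    qed
    then show ?thesis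
      by (metis not_None_eq)
  qed
qed (simp_all add: ord_add_zero ord_add_succ comp_zero comp_succ assms)

lemma comp_halted:
  assumes "good c" "halted P c"
  shows "comp P x c t = Some c"
proof (induction t rule: ordinal_induct)
  case (limit t)
  then have "t \<noteq> 0" by (simp add: is_limit_def)
  then show ?case
    using assms by (subst comp_limit_iff[OF assms(1) limit(1,2)])
      (auto simp: limit_of_def good_def liminf_at_const)
qed (simp_all add: comp_zero comp_succ step_def assms)

end

section \<open>Simulations\<close>

text \<open>
  Register \<open>i\<close> of the simulating machine holds the simulated register \<open>j\<close> if \<open>\<sigma> i = Some j\<close>, and is a
  scratch register with value \<open>K i\<close> at simulated times if \<open>\<sigma> i = None\<close>.
\<close>

definition encode ::
    "(nat \<Rightarrow> nat) \<Rightarrow> (nat \<Rightarrow> nat option) \<Rightarrow> (nat \<Rightarrow> 'a ordinal) \<Rightarrow> 'a config \<Rightarrow> 'a config" where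
  "encode a \<sigma> K c = (a (fst c), \<lambda>i. case \<sigma> i of Some j \<Rightarrow> snd c j | None \<Rightarrow> K i)"

section \<open>Runs with an invariant and the simulation theorem\<close>

context register_machine
begin

text \<open>The invariant is demanded before time \<open>t\<close> only, so that consecutive
  segments meet without overlap.\<close>

definition segment ::
    "prog \<Rightarrow> 'a ordinal set \<Rightarrow> ('a config \<Rightarrow> bool) \<Rightarrow> 'a ordinal \<Rightarrow> 'a config \<Rightarrow> 'a config \<Rightarrow> bool" where
  "segment P x I t c d \<longleftrightarrow> good c \<and> comp P x c t = Some d \<and> (\<forall>u<t. \<exists>e. comp P x c u = Some e \<and> I e)"

lemma segment_zero: "good c \<Longrightarrow> segment P x I 0 c c"
  by (simp add: segment_def comp_zero not_less_zero_ordinal)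

lemma segment_step:
  assumes "good c" "I c"
  shows "segment P x I 1 c (step P x c)"
proof -
  have "u < 1 \<longleftrightarrow> u = 0" for u :: "'a ordinal"
    using zero_ordinal_le[of u] by (auto simp: one_ordinal_def less_ord_succ_iff)
  then show ?thesis
    using assms comp_zero unfolding segment_def by (simp add: comp_zero) (simp add: one_ordinal_def comp_succ comp_zero)
qed

lemma segment_mono: "segment P x I t c d \<Longrightarrow> (\<And>e. I e \<Longrightarrow> J e) \<Longrightarrow> segment P x J t c d"
  unfolding segment_def by blast

lemma segment_good: "segment P x I t c d \<Longrightarrow> good d"
  unfolding segment_def using comp_good by blast

lemma segment_trans:
  assumes "segment P x I s c d" "segment P x I t d e"
  shows "segment P x I (ord_add s t) c e"
proof -
  have c: "good c" "comp P x c s = Some d" and d: "comp P x d t = Some e"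
    using assms by (auto simp: segment_def)
  have "\<exists>f. comp P x c u = Some f \<and> I f" if u: "u < ord_add s t" for u
  proof (cases "u < s")
    case False
    then obtain v where v: "u = ord_add s v"
      using le_imp_ord_add[of s u] by (auto simp: not_less)
    with u have "v < t" by (simp add: ord_add_less_iff)
    with assms(2) show ?thesis
      by (auto simp: v comp_add[OF c] segment_def)
  qed (use assms(1) in \<open>auto simp: segment_def\<close>)
  then show ?thesis
    using c d by (simp add: segment_def comp_add)
qed

definition reach ::
    "prog \<Rightarrow> 'a ordinal set \<Rightarrow> ('a config \<Rightarrow> bool) \<Rightarrow> 'a config \<Rightarrow> 'a config \<Rightarrow> bool" where
  "reach P x I c d \<longleftrightarrow> (\<exists>t. segment P x I t c d)"

lemma reach_refl: "good c \<Longrightarrow> reach P x I c c"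
  unfolding reach_def using segment_zero by blast

lemma reach_trans: "reach P x I c d \<Longrightarrow> reach P x I d e \<Longrightarrow> reach P x I c e"
  unfolding reach_def using segment_trans by blast

lemma reach_step: "good c \<Longrightarrow> I c \<Longrightarrow> reach P x I (step P x c) d \<Longrightarrow> reach P x I c d"
  using reach_trans segment_step unfolding reach_def by blast

lemma reach_mono: "reach P x I c d \<Longrightarrow> (\<And>e. I e \<Longrightarrow> J e) \<Longrightarrow> reach P x J c d"
  unfolding reach_def using segment_mono by blast

lemma reach_good: "reach P x I c d \<Longrightarrow> good d"
  unfolding reach_def using segment_good by blast

text \<open>Small values recur at the stretched times \<open>\<theta> r\<close>. For the lower
  bound, every \<open>v\<close> from \<open>\<theta> s\<close> on lies before some
  \<open>\<theta> (ord_succ w)\<close> with \<open>s \<le> w\<close>, where both terms of the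
  minimum already exceed \<open>m\<close>.\<close>

lemma liminf_at_transfer:
  fixes f :: "'a ordinal \<Rightarrow> 'b::linorder" and \<theta> :: "'a ordinal \<Rightarrow> 'a ordinal"
  assumes t: "is_limit t" and g: "liminf_at t g L"
    and less: "\<And>u v. u < v \<Longrightarrow> v \<le> t \<Longrightarrow> \<theta> u < \<theta> v"
    and cofinal: "\<And>v. v < \<theta> t \<Longrightarrow> \<exists>u<t. v < \<theta> u"
    and fg: "\<And>u. u < t \<Longrightarrow> f (\<theta> u) = g u"
    and between: "\<And>v. v < \<theta> t \<Longrightarrow>
      \<exists>w<t. v < \<theta> (ord_succ w) \<and> min (g w) (g (ord_succ w)) \<le> f v"
  shows "liminf_at (\<theta> t) f L"
  unfolding liminf_at_def
proof (intro conjI allI impI)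
  fix m assume "m < L"
  then obtain s where s: "s < t" "\<And>r. s \<le> r \<Longrightarrow> r < t \<Longrightarrow> m < g r"
    using g unfolding liminf_at_def by blast
  have "m < f v" if v: "\<theta> s \<le> v" "v < \<theta> t" for v
  proof -
    obtain w where w: "w < t" "v < \<theta> (ord_succ w)" "min (g w) (g (ord_succ w)) \<le> f v"
      using between[OF v(2)] by blast
    have "ord_succ w < t" using t w(1) by (simp add: is_limit_def)
    have "s < ord_succ w"
    proof (rule ccontr)
      assume "\<not> ?thesis"
      then have "\<theta> (ord_succ w) \<le> \<theta> s"
        using less[of "ord_succ w" s] s(1) by (metis less_imp_le linorder_neqE order.refl)
      with v(1) w(2) show False by simp
    qed
    then have "m < g w" "m < g (ord_succ w)"
      using s(2)[of w] s(2)[OF less_imp_le, of "ord_succ w"] w(1) \<open>ord_succ w < t\<close>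
      by (auto simp: less_ord_succ_iff)
    then have "m < min (g w) (g (ord_succ w))" by simp
    from this w(3) show ?thesis by (rule less_le_trans)
  qed
  then show "\<exists>s<\<theta> t. \<forall>r. s \<le> r \<longrightarrow> r < \<theta> t \<longrightarrow> m < f r"
    using less[OF s(1)] by blast
next
  fix v assume "v < \<theta> t"
  then obtain u where u: "u < t" "v < \<theta> u" using cofinal by blast
  then obtain r where r: "u \<le> r" "r < t" "g r \<le> L"
    using g unfolding liminf_at_def by blast
  have "\<theta> u \<le> \<theta> r"
    using less[of u r] r by (metis less_imp_le order.order_iff_strict)
  then show "\<exists>r. v \<le> r \<and> r < \<theta> t \<and> f r \<le> L"
    using u r fg less[OF r(2)] by (intro exI[of _ "\<theta> r"]) auto
qed

definition above_min :: "'a config \<Rightarrow> 'a config \<Rightarrow> 'a config \<Rightarrow> bool" where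
  "above_min c d e \<longleftrightarrow> min (fst c) (fst d) \<le> fst e \<and> (\<forall>i. min (snd c i) (snd d i) \<le> snd e i)"

text \<open>Induction on simulated time, where \<open>\<theta> t\<close> is the moment at which
  \<open>t\<close> simulated steps are complete. At limits \<open>above_min\<close> forces the
  configuration to be the encoding of the simulated limit; this includes the scratch registers,
  which are constant at the times \<open>\<theta> u\<close>.\<close>

theorem simulation:
  assumes ci: "good ci" and C: "\<And>t. t \<le> \<tau> \<Longrightarrow> comp S z ci t = Some (C t)"
    and a: "mono a" and K: "\<And>i. K i < \<alpha>"
    and seg: "\<And>t. t < \<tau> \<Longrightarrow> \<exists>\<delta>>0. segment P x
      (\<lambda>e. I e \<and> above_min (encode a \<sigma> K (C t)) (encode a \<sigma> K (C (ord_succ t))) e) \<delta>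
      (encode a \<sigma> K (C t)) (encode a \<sigma> K (C (ord_succ t)))"
  shows "reach P x I (encode a \<sigma> K (C 0)) (encode a \<sigma> K (C \<tau>))"
proof -
  define E where "E t = encode a \<sigma> K (C t)" for t
  define B where "B t e \<longleftrightarrow> I e \<and> above_min (E t) (E (ord_succ t)) e" for t e
  have "\<forall>t. \<exists>\<delta>>0. t < \<tau> \<longrightarrow> segment P x (B t) \<delta> (E t) (E (ord_succ t))"
    using seg unfolding E_def B_def using less_ord_succ by meson
  then obtain D where D: "\<And>t. 0 < D t"
    "\<And>t. t < \<tau> \<Longrightarrow> segment P x (B t) (D t) (E t) (E (ord_succ t))"
    by metis
  define \<theta> where "\<theta> = ord_rec 0 (\<lambda>t T. ord_add T (D t)) (\<lambda>\<eta> f. SUP \<delta>\<in>{..<\<eta>}. f \<delta>)"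
  have \<theta>_less: "\<theta> u < \<theta> v" if "u < v" for u v
    by (rule normal_less[OF \<theta>_def]) (use that D(1) less_ord_add in auto)
  have goodC: "good (C t)" if "t \<le> \<tau>" for t
    using comp_good[OF ci C[OF that]] .
  have goodE: "good (E t)" if "t \<le> \<tau>" for t
    using goodC[OF that] K by (auto simp: E_def good_def encode_def split: option.split)
  have "segment P x I (\<theta> t) (E 0) (E t)" if "t \<le> \<tau>" for t
    using that
  proof (induction t rule: ordinal_induct)
    case zero
    then show ?case
      using goodE by (simp add: normal_zero[OF \<theta>_def] segment_zero)
  next
    case (succ t)
    then have t: "t < \<tau>" using less_ord_succ[of t] by simp
    then have "segment P x I (D t) (E t) (E (ord_succ t))"
      using segment_mono[OF D(2)[OF t]] by (simp add: B_def)
    with succ.IH t show ?case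
      unfolding normal_succ[OF \<theta>_def] by (meson less_imp_le segment_trans)
  next
    case (limit t)
    note t = limit(1)
    have run: "comp P x (E 0) (\<theta> u) = Some (E u)" "good (E 0)" if "u < t" for u
      using limit(2)[OF that] limit(3) that by (auto simp: segment_def)
    have t0: "t \<noteq> 0" "0 < t" using t by (auto simp: is_limit_def zero_less_ordinal)
    have cofinal: "\<exists>u<t. v < \<theta> u" if "v < \<theta> t" for v
      using normal_less_limit[OF \<theta>_def t that] by metis
    have \<theta>t: "is_limit (\<theta> t)"
    proof -
      have "\<theta> t \<noteq> 0"
        using \<theta>_less[OF t0(2)] not_less_zero_ordinal by metis
      moreover have "ord_succ v < \<theta> t" if v: "v < \<theta> t" for v
        using cofinal[OF v] \<theta>_less ord_succ_le by (meson le_less_trans)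
      ultimately show ?thesis by (simp add: is_limit_def)
    qed
    have between: "\<exists>w<t. v < \<theta> (ord_succ w) \<and> (\<exists>e. comp P x (E 0) v = Some e \<and> B w e)"
      if v: "v < \<theta> t" for v
    proof -
      \<comment> \<open>The segment containing \<open>v\<close> ends at the least
        \<open>\<theta> u\<close> above \<open>v\<close>. As \<open>\<theta>\<close> starts at 0 and
        is continuous, \<open>u\<close> is a successor; its predecessor is the required
        \<open>w\<close>.\<close>
      define u where "u = (LEAST u. v < \<theta> u)"
      obtain u' where u': "u' < t" "v < \<theta> u'" using cofinal[OF v] by blast
      have u: "v < \<theta> u" unfolding u_def by (rule LeastI) (rule u'(2))
      have least: "\<theta> s \<le> v" if "s < u" for s
        using not_less_Least[OF that[unfolded u_def]] by simp
      have "u \<le> u'" unfolding u_def by (rule Least_le) (rule u'(2))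
      then have "u < t" using u'(1) by simp
      show ?thesis
      proof (cases u rule: ordinal_limit_cases)
        case 1
        then show ?thesis
          using u by (simp add: normal_zero[OF \<theta>_def] not_less_zero_ordinal)
      next
        case (2 w)
        then obtain d where d: "v = ord_add (\<theta> w) d"
          using least le_imp_ord_add by metis
        have "d < D w"
          using u unfolding 2(2) d normal_succ[OF \<theta>_def] by (simp add: ord_add_less_iff)
        moreover have w: "w < t" using 2 \<open>u < t\<close> by simp
        moreover have "w < \<tau>" using w limit(3) by simp
        ultimately have "\<exists>e. comp P x (E w) d = Some e \<and> B w e"
          using D(2) by (auto simp: segment_def)
        then show ?thesis
          using w u 2(2) run[OF w] by (auto simp: d comp_add)
      next
        case 3
        then show ?thesis
          using normal_less_limit[OF \<theta>_def is_limitI[OF 3] u] least by (metis leD)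
      qed
    qed
    define F where "F v = the (comp P x (E 0) v)" for v
    have F: "comp P x (E 0) v = Some (F v)" "I (F v)"
      "\<exists>w<t. v < \<theta> (ord_succ w) \<and> above_min (E w) (E (ord_succ w)) (F v)" if "v < \<theta> t" for v
      using between[OF that] by (auto simp: F_def B_def)
    have FE: "F (\<theta> u) = E u" if "u < t" for u
      using run[OF that] by (simp add: F_def)
    have "limit_of t C (C t)"
      using comp_limit_iff[OF ci t, of S z C "C t"] C limit(3) by auto
    then have lim: "liminf_at t (\<lambda>s. fst (C s)) (fst (C t))"
      "\<And>i. liminf_at t (\<lambda>s. snd (C s) i) (snd (C t) i)"
      by (auto simp: limit_of_def)
    have limE: "liminf_at t (\<lambda>s. fst (E s)) (fst (E t))"
      "liminf_at t (\<lambda>s. snd (E s) i) (snd (E t) i)" for i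
      using liminf_at_mono[OF lim(1) a t0(1)] lim(2)
      by (auto simp: E_def encode_def liminf_at_const[OF t0(1)] split: option.split)
    have "limit_of (\<theta> t) F (E t)"
      unfolding limit_of_def
    proof (intro conjI allI)
      show "liminf_at (\<theta> t) (\<lambda>v. fst (F v)) (fst (E t))"
        by (rule liminf_at_transfer[OF t limE(1) \<theta>_less cofinal])
          (use F(3) in \<open>simp_all add: FE above_min_def, meson\<close>)
      show "liminf_at (\<theta> t) (\<lambda>v. snd (F v) i) (snd (E t) i)" for i
        by (rule liminf_at_transfer[OF t limE(2) \<theta>_less cofinal])
          (use F(3) in \<open>simp_all add: FE above_min_def, meson\<close>)
      show "snd (E t) i < \<alpha>" for i
        using goodE[OF limit(3)] by (simp add: good_def)
    qed
    then have "comp P x (E 0) (\<theta> t) = Some (E t)"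
      using comp_limit_iff[OF run(2)[OF t0(2)] \<theta>t F(1)] by simp
    then show ?case
      using F(1,2) run(2)[OF t0(2)] by (auto simp: segment_def)
  qed
  then show ?thesis
    by (auto simp: reach_def E_def)
qed

end

section \<open>Translated commands and block-structured programs\<close>

definition instr_regs :: "instr \<Rightarrow> nat set" where
  "instr_regs i = (case i of Incr a \<Rightarrow> {a} | Copy a b \<Rightarrow> {a, b} | JumpEq a b _ \<Rightarrow> {a, b} | Oracle a \<Rightarrow> {a})"

definition regs_below :: "nat \<Rightarrow> prog \<Rightarrow> bool" where
  "regs_below n P \<longleftrightarrow> (\<forall>i\<in>set P. instr_regs i \<subseteq> {..<n})"

lemma regs_below_exists: "\<exists>n\<ge>m. regs_below n P"
proof -
  have fin: "finite (\<Union>i\<in>set P. instr_regs i)"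
    by (auto simp: instr_regs_def split: instr.split)
  then obtain k where k: "\<forall>r\<in>(\<Union>i\<in>set P. instr_regs i). r < k"
    using finite_nat_set_iff_bounded by meson
  then have "regs_below (max m k) P"
    unfolding regs_below_def by (auto simp: less_max_iff_disj)
  then show ?thesis by (meson max.cobounded1)
qed

text \<open>
  Register \<open>Z\<close> always contains \<open>0\<close>, so that oracle calls are answered as with the empty oracle.
\<close>

fun translate :: "(nat \<Rightarrow> nat) \<Rightarrow> nat \<Rightarrow> nat \<Rightarrow> instr \<Rightarrow> instr" where
  "translate a n Z (Incr i) = Incr (n + i)"
| "translate a n Z (Copy i j) = Copy (n + i) (n + j)"
| "translate a n Z (JumpEq i j k) = JumpEq (n + i) (n + j) (a k)"
| "translate a n Z (Oracle j) = Copy Z (n + j)"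

text \<open>Simulated registers are shifted up by \<open>n\<close>. This frees the registers below
  \<open>n\<close> for a subroutine at its original register numbers, and leaves register
  \<open>n + m\<close> outside the window for the constant 0.\<close>

definition window :: "nat \<Rightarrow> nat \<Rightarrow> nat \<Rightarrow> nat option" where
  "window n m i = (if n \<le> i \<and> i < n + m then Some (i - n) else None)"

text \<open>The last assumption lets falling through lead to where \<open>a\<close> places the next
  line, so a translated command has to end its block. Copying from \<open>Z\<close> answers oracle
  commands correctly only for the empty oracle, whence the second assumption.\<close>

lemma exec_translate:
  assumes "instr_regs i \<subseteq> {..<m}" "z = {} \<or> (\<forall>j. i \<noteq> Oracle j)"
    and "\<And>j. j < m \<Longrightarrow> R (n + j) = snd c j" "R Z = 0" "Suc p = a (Suc (fst c))"
  shows "exec y (translate a n Z i) (p, R) = encode a (window n m) R (exec z i c)"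
proof -
  have "R k = snd c (k - n)" if "n \<le> k" "k < n + m" for k
    using assms(3)[of "k - n"] that by simp
  then show ?thesis
    using assms by (cases i; cases c) (auto simp: encode_def window_def instr_regs_def fun_eq_iff)
qed

definition code_at :: "prog \<Rightarrow> nat \<Rightarrow> prog \<Rightarrow> bool" where
  "code_at P p xs \<longleftrightarrow> (\<forall>j<length xs. p + j < length P \<and> P ! (p + j) = xs ! j)"

lemma code_at_Cons: "code_at P p (i # xs) \<longleftrightarrow> p < length P \<and> P ! p = i \<and> code_at P (Suc p) xs"
  by (auto simp: code_at_def All_less_Suc2)

lemma code_at_append: "code_at P p (xs @ ys) \<longleftrightarrow> code_at P p xs \<and> code_at P (p + length xs) ys"
proof (induction xs arbitrary: p)
  case (Cons i xs)
  then show ?case by (simp add: code_at_Cons)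
qed (simp add: code_at_def)

lemma length_concat_blocks:
  assumes "\<And>l. length (blk l) = B"
  shows "length (concat (map blk [0..<N])) = N * B"
  by (induction N) (simp_all add: assms)

lemma code_at_concat_blocks:
  assumes "\<And>l. length (blk l) = B" "l < N"
  shows "code_at (concat (map blk [0..<N]) @ xs) (l * B) (blk l)"
proof -
  have "[0..<N] = [0..<l] @ l # [Suc l..<N]"
    using assms(2) upt_add_eq_append[of 0 l "N - l"] by (simp add: upt_conv_Cons)
  then have "concat (map blk [0..<N]) @ xs =
      concat (map blk [0..<l]) @ blk l @ (concat (map blk [Suc l..<N]) @ xs)"
    by simp
  then show ?thesis
    unfolding code_at_def
    using length_concat_blocks[of blk B l] assms(1) by (simp add: nth_append)
qed

context register_machine
begin

text \<open>Splitting off the first machine step guarantees segments of positive length, which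
  \<open>simulation\<close> needs for a strictly increasing time map.\<close>

lemma simulation_steps:
  assumes "good ci" "\<And>t. t \<le> \<tau> \<Longrightarrow> comp S z ci t = Some (C t)"
    and "mono a" "\<And>i. K i < \<alpha>"
    and I: "\<And>t. t < \<tau> \<Longrightarrow> I (encode a \<sigma> K (C t))"
    and r: "\<And>t. t < \<tau> \<Longrightarrow> reach P x
      (\<lambda>e. I e \<and> above_min (encode a \<sigma> K (C t)) (encode a \<sigma> K (step S z (C t))) e)
      (step P x (encode a \<sigma> K (C t))) (encode a \<sigma> K (step S z (C t)))"
  shows "reach P x I (encode a \<sigma> K (C 0)) (encode a \<sigma> K (C \<tau>))"
proof (rule simulation[OF assms(1-4)])
  fix t assume t: "t < \<tau>"
  let ?E = "\<lambda>t. encode a \<sigma> K (C t)"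
  have "Some (C (ord_succ t)) = Some (step S z (C t))"
    using t assms(2)[of t] assms(2)[of "ord_succ t"] by (simp add: comp_succ ord_succ_le)
  then have succ: "C (ord_succ t) = step S z (C t)" by simp
  have "good (C t)"
    using comp_good[OF assms(1,2), of t] t by simp
  then have "good (?E t)"
    using assms(4) by (auto simp: good_def encode_def split: option.split)
  then have "segment P x (\<lambda>e. I e \<and> above_min (?E t) (?E (ord_succ t)) e) 1 (?E t) (step P x (?E t))"
    using I[OF t] by (intro segment_step) (auto simp: above_min_def)
  moreover obtain \<delta> where
    "segment P x (\<lambda>e. I e \<and> above_min (?E t) (?E (ord_succ t)) e) \<delta> (step P x (?E t)) (?E (ord_succ t))"
    using r[OF t] by (auto simp: reach_def succ)
  ultimately have "segment P x (\<lambda>e. I e \<and> above_min (?E t) (?E (ord_succ t)) e) (ord_add 1 \<delta>)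
      (?E t) (?E (ord_succ t))"
    by (rule segment_trans)
  moreover have "0 < ord_add 1 \<delta>"
    using le_ord_add[of 1 \<delta>] less_ord_succ[of 0] by (metis less_le_trans one_ordinal_def)
  ultimately show "\<exists>\<delta>>0. segment P x (\<lambda>e. I e \<and> above_min (?E t) (?E (ord_succ t)) e) \<delta> (?E t) (?E (ord_succ t))"
    by blast
qed

lemma lockstep_simulation:
  assumes "good ci" "\<And>t. t \<le> \<tau> \<Longrightarrow> comp S z ci t = Some (C t)"
    and "mono a" "\<And>i. K i < \<alpha>"
    and "\<And>t. t < \<tau> \<Longrightarrow> I (encode a \<sigma> K (C t))"
    and st: "\<And>t. t < \<tau> \<Longrightarrow> step P x (encode a \<sigma> K (C t)) = encode a \<sigma> K (step S z (C t))"
  shows "reach P x I (encode a \<sigma> K (C 0)) (encode a \<sigma> K (C \<tau>))"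
proof (rule simulation_steps[where I = I, OF assms(1-5)])
  fix t assume t: "t < \<tau>"
  then have "good (C t)"
    using comp_good[OF assms(1,2), of t] by simp
  then have "good (step S z (C t))"
    by (rule good_step)
  then have "good (encode a \<sigma> K (step S z (C t)))"
    using assms(4) by (auto simp: good_def encode_def split: option.split)
  then show "reach P x (\<lambda>e. I e \<and> above_min (encode a \<sigma> K (C t)) (encode a \<sigma> K (step S z (C t))) e)
      (step P x (encode a \<sigma> K (C t))) (encode a \<sigma> K (step S z (C t)))"
    by (simp add: st[OF t] reach_refl)
qed

lemma reach_exec:
  assumes "good (l, R)" "I (l, R)" "l < length P" "P ! l = i"
    and "good (exec x i (l, R)) \<Longrightarrow> reach P x I (exec x i (l, R)) d"
  shows "reach P x I (l, R) d"
proof (rule reach_step[where I = I, OF assms(1,2)])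
  have "step P x (l, R) = exec x i (l, R)"
    using assms(3,4) by (simp add: step_def halted_def)
  then show "reach P x I (step P x (l, R)) d"
    using assms(5) good_step[OF assms(1), of P x] by simp
qed

section \<open>Halting runs and subroutine calls\<close>

abbreviation start :: "'a ordinal list \<Rightarrow> 'a config" where
  "start inputs \<equiv> (0, \<lambda>i. if i < length inputs then inputs ! i else 0)"

lemma good_start: "set inputs \<subseteq> {..<\<alpha>} \<Longrightarrow> good (start inputs)"
  using zero_less nth_mem by (auto simp: good_def)

text \<open>The witness of \<open>reach\<close> may lie past the halting time, but a halted
  configuration persists, so \<open>d\<close> already occurs at the first halted time.\<close>

lemma halts_with_reach:
  assumes "reach P x I (start inputs) d" "halted P d"
  shows "\<exists>\<tau> c. halts_at \<alpha> P x inputs \<tau> c \<and> snd c 0 = snd d 0"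
proof -
  obtain T where T: "good (start inputs)" "comp P x (start inputs) T = Some d"
    using assms(1) by (auto simp: reach_def segment_def)
  define \<tau> where "\<tau> = (LEAST t. \<exists>e. comp P x (start inputs) t = Some e \<and> halted P e)"
  have "\<exists>e. comp P x (start inputs) \<tau> = Some e \<and> halted P e"
    unfolding \<tau>_def by (rule LeastI[of _ T]) (use T assms(2) in blast)
  then obtain e where e: "comp P x (start inputs) \<tau> = Some e" "halted P e" by blast
  have "\<tau> \<le> T"
    unfolding \<tau>_def by (rule Least_le) (use T assms(2) in blast)
  then obtain u where "T = ord_add \<tau> u" by (rule le_imp_ord_add)
  then have "d = e"
    using T e comp_add[OF T(1) e(1), where t = u]
      comp_halted[OF comp_good[OF T(1) e(1)] e(2), where t = u] by simp
  moreover have "\<exists>f. comp P x (start inputs) t = Some f \<and> \<not> halted P f" if "t < \<tau>" for t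
    using comp_defined_le[OF e(1) less_imp_le[OF that]] not_less_Least[OF that[unfolded \<tau>_def]]
    by auto
  ultimately have "halts_at \<alpha> P x inputs \<tau> e" "snd e 0 = snd d 0"
    using e by (simp_all add: halts_at_def run_eq_computation)
  then show ?thesis by blast
qed

lemma halts_at_unique:
  assumes "halts_at \<alpha> P x inputs \<tau> c" "halts_at \<alpha> P x inputs \<tau>' c'"
  shows "\<tau> = \<tau>' \<and> c = c'"
proof -
  have "\<not> \<tau> < \<tau>'" "\<not> \<tau>' < \<tau>"
    using assms unfolding halts_at_def by fastforce+
  then show ?thesis
    using assms by (auto simp: halts_at_def)
qed

lemma clear_registers:
  assumes "good (p, R)" "code_at H p (map (Copy Z) [1..<Suc m])" "m < Z" "R Z = 0"
    and I: "\<And>l R'. p \<le> l \<Longrightarrow> (\<And>i. \<not> (1 \<le> i \<and> i \<le> m) \<Longrightarrow> R' i = R i) \<Longrightarrow> I (l, R')"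
  shows "reach H y I (p, R) (p + m, \<lambda>i. if 1 \<le> i \<and> i \<le> m then 0 else R i)"
  using assms(2,3) I
proof (induction m)
  case 0
  have "(\<lambda>i. if 1 \<le> i \<and> i \<le> 0 then 0 else R i) = R"
    by auto
  then show ?case using assms(1) by (simp add: reach_refl)
next
  case (Suc m)
  let ?R = "\<lambda>m i. if 1 \<le> i \<and> i \<le> m then 0 else R i"
  have upt: "[1..<Suc (Suc m)] = [1..<Suc m] @ [Suc m]"
    by simp
  have code: "code_at H p (map (Copy Z) [1..<Suc m])" "p + m < length H" "H ! (p + m) = Copy Z (Suc m)"
    using Suc.prems(1) unfolding upt
    by (auto simp: code_at_append code_at_Cons simp del: upt_Suc)
  have "reach H y I (p, R) (p + m, ?R m)"
  proof (rule Suc.IH[OF code(1)])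
    show "I (l, R')" if "p \<le> l" "\<And>i. \<not> (1 \<le> i \<and> i \<le> m) \<Longrightarrow> R' i = R i" for l R'
      by (rule Suc.prems(3)) (use that in auto)
  qed (use Suc.prems(2) in simp)
  also have "reach H y I (p + m, ?R m) (p + Suc m, ?R (Suc m))"
  proof (rule reach_exec[OF _ _ code(2,3)])
    have R': "(?R m)(Suc m := ?R m Z) = ?R (Suc m)"
      using Suc.prems(2) assms(4) by auto
    show "reach H y I (exec y (Copy Z (Suc m)) (p + m, ?R m)) (p + Suc m, ?R (Suc m))"
      if "good (exec y (Copy Z (Suc m)) (p + m, ?R m))"
      using that reach_refl by (simp only: exec.simps R') simp
    show "I (p + m, ?R m)"
      by (rule Suc.prems(3)) auto
  qed (use Suc.prems(3) assms(1) zero_less in \<open>auto simp: good_def\<close>)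
  finally (reach_trans) show ?case .
qed

text \<open>Clamping at \<open>length Q\<close> sends every halting line of \<open>Q\<close> to the
  first line behind its copy, so that halting becomes entering the clean-up code. That code resets
  registers \<open>1\<close> to \<open>n - 1\<close> and keeps the answer in register 0.\<close>

definition subroutine :: "prog \<Rightarrow> nat \<Rightarrow> nat \<Rightarrow> nat \<Rightarrow> prog" where
  "subroutine Q n Z p = map (translate (\<lambda>k. p + min k (length Q)) 0 Z) Q @ map (Copy Z) [1..<n]"

lemma length_subroutine: "length (subroutine Q n Z p) = length Q + (n - 1)"
  by (simp add: subroutine_def)

lemma reach_subroutine:
  assumes halts: "halts_with \<alpha> Q {} [\<iota>, 0] v" and Q: "regs_below n Q" and n: "2 \<le> n" "n \<le> Z"
    and code: "code_at H p (subroutine Q n Z p)" and good: "good (p, R)"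
    and R: "R 0 = \<iota>" "\<And>i. 0 < i \<Longrightarrow> i < n \<Longrightarrow> R i = 0" "R Z = 0"
    and I: "\<And>l R'. p \<le> l \<Longrightarrow> (\<And>i. n \<le> i \<Longrightarrow> R' i = R i) \<Longrightarrow> I (l, R')"
  shows "reach H y I (p, R) (p + length Q + (n - 1), R(0 := v))"
proof -
  let ?a = "\<lambda>k. p + min k (length Q)" and ?ci = "start [\<iota>, 0]"
  obtain \<tau> c where hc: "halts_at \<alpha> Q {} [\<iota>, 0] \<tau> c" "snd c 0 = v"
    using halts by (auto simp: halts_with_def)
  define C where "C t = the (comp Q {} ?ci t)" for t
  have C: "comp Q {} ?ci t = Some (C t)" if "t \<le> \<tau>" for t
    using comp_defined_le[of Q "{}" ?ci \<tau> c t] hc(1) that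
    by (auto simp: halts_at_def run_eq_computation C_def)
  have run: "\<not> halted Q (C t)" if "t < \<tau>" for t
    using hc(1) that by (fastforce simp: halts_at_def run_eq_computation C_def)
  have C\<tau>: "C \<tau> = c" and hal: "halted Q c"
    using hc(1) by (auto simp: halts_at_def run_eq_computation C_def)
  have code': "code_at H p (map (translate ?a 0 Z) Q)"
    "code_at H (p + length Q) (map (Copy Z) [1..<Suc (n - 1)])"
    using code n by (auto simp: subroutine_def code_at_append)
  have ci: "good ?ci"
    using good R(1) zero_less by (intro good_start) (auto simp: good_def)
  let ?E = "encode ?a (window 0 n) R"
  have "reach H y I (?E (C 0)) (?E (C \<tau>))"
  proof (rule lockstep_simulation[OF ci C])
    fix t assume t: "t < \<tau>"
    define l where "l = fst (C t)"
    have l: "l < length Q" using run[OF t] by (simp add: halted_def l_def)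
    then have at: "p + l < length H" "H ! (p + l) = translate ?a 0 Z (Q ! l)"
      using code'(1) by (auto simp: code_at_def)
    define R1 where "R1 = (\<lambda>i. if i < n then snd (C t) i else R i)"
    have E: "?E (C t) = (p + l, R1)"
      using l by (auto simp: encode_def window_def R1_def l_def)
    have "step H y (?E (C t)) = exec y (translate ?a 0 Z (Q ! l)) (p + l, R1)"
      using at by (simp add: E step_def halted_def)
    also have "\<dots> = encode ?a (window 0 n) R1 (exec {} (Q ! l) (C t))"
      using l Q n R(3)
      by (intro exec_translate) (auto simp: regs_below_def R1_def l_def)
    also have "\<dots> = ?E (step Q {} (C t))"
      using l by (auto simp: encode_def window_def step_def halted_def l_def R1_def)
    finally show "step H y (?E (C t)) = ?E (step Q {} (C t))" .
  next
    show "mono ?a" by (auto simp: mono_def)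
  next
    show "R i < \<alpha>" for i using good by (simp add: good_def)
  qed (auto simp: encode_def window_def intro!: I)
  also have "?E (C 0) = (p, R)"
    using R(1,2) n by (auto simp: C_def comp_zero encode_def window_def fun_eq_iff less_Suc_eq)
  finally have 1: "reach H y I (p, R) (?E c)"
    by (simp add: C\<tau>)
  have Ec: "?E c = (p + length Q, \<lambda>i. if i < n then snd c i else R i)"
    using hal by (auto simp: encode_def window_def halted_def)
  define R' where "R' = (\<lambda>i. if i < n then snd c i else R i)"
  have "reach H y I (p + length Q, R')
      (p + length Q + (n - 1), \<lambda>i. if 1 \<le> i \<and> i \<le> n - 1 then 0 else R' i)"
    using reach_good[OF 1] code'(2) n R(3)
    by (intro clear_registers) (auto simp: Ec R'_def intro!: I)
  also have "(\<lambda>i. if 1 \<le> i \<and> i \<le> n - 1 then 0 else R' i) = R(0 := v)"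
  proof
    show "(if 1 \<le> i \<and> i \<le> n - 1 then 0 else R' i) = (R(0 := v)) i" for i
      using hc(2) n R(2)[of i] by (cases "i = 0"; cases "i < n") (auto simp: R'_def)
  qed
  finally have "reach H y I (?E c) (p + length Q + (n - 1), R(0 := v))"
    by (simp only: Ec R'_def)
  with 1 show ?thesis by (rule reach_trans)
qed

lemma halts_at_trajectory:
  assumes "halts_at \<alpha> P x inputs \<tau> c"
  obtains C where "\<And>t. t \<le> \<tau> \<Longrightarrow> comp P x (start inputs) t = Some (C t)"
    "\<And>t. t < \<tau> \<Longrightarrow> \<not> halted P (C t)" "C 0 = start inputs" "C \<tau> = c" "halted P c"
proof
  let ?C = "\<lambda>t. the (comp P x (start inputs) t)"
  show C: "comp P x (start inputs) t = Some (?C t)" if "t \<le> \<tau>" for t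
    using comp_defined_le[of P x "start inputs" \<tau> c t] assms that
    by (auto simp: halts_at_def run_eq_computation)
  show "\<not> halted P (?C t)" if "t < \<tau>" for t
    using assms that by (fastforce simp: halts_at_def run_eq_computation)
qed (use assms in \<open>auto simp: halts_at_def run_eq_computation comp_zero\<close>)

text \<open>Registers below \<open>n\<close> are 0 at simulated times, so whatever they contain in
  between respects the lower bound.\<close>

lemma above_min_encode:
  assumes "fst (encode a (window n m) (\<lambda>_. 0) c) \<le> l"
    and "\<And>i. n \<le> i \<Longrightarrow> R i = snd (encode a (window n m) (\<lambda>_. 0) c) i
      \<or> R i = snd (encode a (window n m) (\<lambda>_. 0) d) i"
  shows "above_min (encode a (window n m) (\<lambda>_. 0) c) (encode a (window n m) (\<lambda>_. 0) d) (l, R)"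
  unfolding above_min_def
proof (intro conjI allI)
  fix i
  show "min (snd (encode a (window n m) (\<lambda>_. 0) c) i) (snd (encode a (window n m) (\<lambda>_. 0) d) i)
      \<le> snd (l, R) i"
  proof (cases "n \<le> i")
    case True
    from assms(2)[OF this] show ?thesis by auto
  next
    case False
    then show ?thesis
      using zero_ordinal_le by (simp add: encode_def window_def)
  qed
qed (use assms(1) in auto)

text \<open>The \<open>step\<close> in the first conclusion performs the initial load into register
  0, which matches the form required by \<open>simulation_steps\<close>. The offset
  \<open>length Q + n\<close> is this load plus the length of the subroutine.\<close>

lemma block_call:
  fixes c :: "'a config" and R n m p a
  defines "R \<equiv> snd (encode a (window n m) (\<lambda>_. 0) c)"
  assumes Q: "regs_below n Q" "2 \<le> n" and good: "good c" and q: "q < m"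
    and code: "code_at H p (Copy (n + q) 0 # subroutine Q n (n + m) (Suc p) @ xs)"
    and halts: "halts_with \<alpha> Q {} [snd c q, 0] v"
    and I: "\<And>l' R'. p \<le> l' \<Longrightarrow> (\<And>i. n \<le> i \<Longrightarrow> R' i = R i) \<Longrightarrow> I (l', R')"
    and a: "a (fst c) = p"
  shows "reach H y I (step H y (encode a (window n m) (\<lambda>_. 0) c)) (p + (length Q + n), R(0 := v))"
    and "code_at H (p + (length Q + n)) xs"
proof -
  have E: "encode a (window n m) (\<lambda>_. 0) c = (p, R)"
    by (simp add: R_def encode_def a)
  have gE: "good (encode a (window n m) (\<lambda>_. 0) c)"
    using good zero_less by (auto simp: good_def encode_def split: option.split)
  have Rlow: "R i = 0" if "i < n" for i
    using that by (simp add: R_def encode_def window_def)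
  have RZ: "R (n + m) = 0" "R (n + q) = snd c q"
    using q by (simp_all add: R_def encode_def window_def)
  have code': "p < length H" "H ! p = Copy (n + q) 0" "code_at H (Suc p) (subroutine Q n (n + m) (Suc p))"
    "code_at H (Suc p + (length Q + (n - 1))) xs"
    using code by (auto simp: code_at_Cons code_at_append length_subroutine)
  then show "code_at H (p + (length Q + n)) xs"
    using Q(2) by (simp add: add.assoc)
  have st: "step H y (encode a (window n m) (\<lambda>_. 0) c) = (Suc p, R(0 := snd c q))"
    using code' by (simp add: E step_def halted_def RZ)
  have "reach H y I (Suc p, R(0 := snd c q))
      (Suc p + length Q + (n - 1), (R(0 := snd c q))(0 := v))"
  proof (rule reach_subroutine[OF halts Q(1,2) _ code'(3)])
    show "good (Suc p, R(0 := snd c q))"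
      using good_step[OF gE, of H y] by (simp only: st)
    show "I (l, R')" if "Suc p \<le> l" "\<And>i. n \<le> i \<Longrightarrow> R' i = (R(0 := snd c q)) i" for l R'
      using that Q(2) by (intro I) auto
  qed (use Q(2) Rlow RZ q in auto)
  then show "reach H y I (step H y (encode a (window n m) (\<lambda>_. 0) c)) (p + (length Q + n), R(0 := v))"
    using Q(2) by (simp add: st add.assoc)
qed

section \<open>From recognition to searching and back\<close>

lemma recognizer_queries_everything:
  assumes rec: "\<And>y. y \<subseteq> {..<\<alpha>} \<Longrightarrow> halts_with \<alpha> P y [0] (if y = x then 1 else 0)"
    and x: "x \<subseteq> {..<\<alpha>}" and \<iota>: "\<iota> < \<alpha>"
    and C: "\<And>t. t \<le> \<tau> \<Longrightarrow> comp P x (start [0]) t = Some (C t)" "C 0 = start [0]"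
    and halted: "\<And>t. t < \<tau> \<Longrightarrow> \<not> halted P (C t)" "halted P (C \<tau>)"
  obtains t j where "t < \<tau>" "P ! fst (C t) = Oracle j" "snd (C t) j = \<iota>"
proof (rule ccontr)
  assume "\<not> thesis"
  with that have no: "snd (C t) j \<noteq> \<iota>" if "t < \<tau>" "P ! fst (C t) = Oracle j" for t j
    using that by blast
  define y where "y = (if \<iota> \<in> x then x - {\<iota>} else insert \<iota> x)"
  have y: "y \<subseteq> {..<\<alpha>}" "y \<noteq> x" and y_iff: "\<And>\<kappa>. \<kappa> \<noteq> \<iota> \<Longrightarrow> \<kappa> \<in> y \<longleftrightarrow> \<kappa> \<in> x"
    using x \<iota> by (auto simp: y_def)
  \<comment> \<open>With the identity encoding, lockstep simulation compares two runs of the same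
    program under different oracles.\<close>
  have id: "encode id Some (\<lambda>_. 0) c = c" for c :: "'a config"
    by (simp add: encode_def)
  have same: "reach P z (\<lambda>_. True) (start [0]) (C \<tau>)" if z: "z = x \<or> z = y" for z
  proof -
    have "reach P z (\<lambda>_. True) (encode id Some (\<lambda>_. 0) (C 0)) (encode id Some (\<lambda>_. 0) (C \<tau>))"
    proof (rule lockstep_simulation[where ci = "start [0]", OF _ C(1)])
      show "good (start [0 :: 'a ordinal])"
        using zero_less by (intro good_start) auto
      fix t assume t: "t < \<tau>"
      have "exec z (P ! fst (C t)) (C t) = exec x (P ! fst (C t)) (C t)"
        using z no[OF t] y_iff by (cases "C t"; cases "P ! fst (C t)") auto
      then show "step P z (encode id Some (\<lambda>_. 0) (C t)) = encode id Some (\<lambda>_. 0) (step P x (C t))"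
        by (simp add: id step_def)
    qed (auto simp: zero_less mono_def)
    then show ?thesis by (simp only: id C(2))
  qed
  have val: "snd (C \<tau>) 0 = (if z = x then 1 else 0)" if z: "z = x \<or> z = y" for z
  proof -
    obtain \<tau>1 c1 where 1: "halts_at \<alpha> P z [0] \<tau>1 c1" "snd c1 0 = snd (C \<tau>) 0"
      using halts_with_reach[OF same[OF z] halted(2)] by blast
    obtain \<tau>2 c2 where 2: "halts_at \<alpha> P z [0] \<tau>2 c2" "snd c2 0 = (if z = x then 1 else 0)"
      using rec[of z] z x y(1) unfolding halts_with_def by blast
    show ?thesis using halts_at_unique[OF 1(1) 2(1)] 1(2) 2(2) by simp
  qed
  from val[of x] val[of y] y(2) show False
    using zero_less_one by auto
qed

lemma searchable_if_recognizable:
  assumes "wITRM_computable \<alpha> x" "wITRM_recognizable \<alpha> x"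
  shows "wITRM_searchable \<alpha>"
proof -
  obtain Q where x: "x \<subseteq> {..<\<alpha>}"
    and Q: "\<And>\<iota>. \<iota> < \<alpha> \<Longrightarrow> halts_with \<alpha> Q {} [\<iota>, 0] (if \<iota> \<in> x then 1 else 0)"
    using assms(1) by (auto simp: wITRM_computable_def)
  obtain S where S: "\<And>y. y \<subseteq> {..<\<alpha>} \<Longrightarrow> halts_with \<alpha> S y [0] (if y = x then 1 else 0)"
    using assms(2) by (auto simp: wITRM_recognizable_def)
  obtain n where n: "2 \<le> n" "regs_below n Q" using regs_below_exists by blast
  obtain m where m: "1 \<le> m" "regs_below m S" using regs_below_exists by blast
  obtain \<tau> c where "halts_at \<alpha> S x [0] \<tau> c"
    using S[OF x] by (auto simp: halts_with_def)
  then obtain C where C: "\<And>t. t \<le> \<tau> \<Longrightarrow> comp S x (start [0]) t = Some (C t)"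
      "\<And>t. t < \<tau> \<Longrightarrow> \<not> halted S (C t)" "C 0 = start [0]" "halted S (C \<tau>)"
    by (rule halts_at_trajectory) blast
  \<comment> \<open>\<open>B\<close> counts the load, the \<open>length Q + (n - 1)\<close> lines of
    the subroutine and the two lines of \<open>post\<close>. In the next line, \<open>a\<close>
    sends all halting lines of \<open>S\<close> to \<open>N * B\<close>, the length of
    \<open>H\<close>.\<close>
  define N B Z where "N = length S" "B = length Q + n + 2" "Z = n + m"
  define a where "a l = min l N * B" for l
  \<comment> \<open>Blocks of other commands call \<open>Q\<close> too, on register 0 of
    \<open>S\<close>, which keeps all blocks equally long. In \<open>post\<close> their command
    comes last because it may jump, so register 0 is cleared before it.\<close>
  define q where "q l = (case S ! l of Oracle j \<Rightarrow> j | _ \<Rightarrow> 0)" for l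
  define post where "post l = (case S ! l of Oracle j \<Rightarrow> [Copy 0 (n + j), Copy Z 0]
    | i \<Rightarrow> [Copy Z 0, translate a n Z i])" for l
  define blk where "blk l = Copy (n + q l) 0 # subroutine Q n Z (Suc (l * B)) @ post l" for l
  define H where "H = concat (map blk [0..<N])"
  have lpost: "length (post l) = 2" for l
    by (simp add: post_def split: instr.split)
  have lblk: "length (blk l) = B" for l
    using n by (simp add: blk_def length_subroutine lpost N_B_Z_def)
  have lH: "length H = N * B"
    unfolding H_def by (rule length_concat_blocks[OF lblk])
  have code: "code_at H (l * B) (blk l)" if "l < N" for l
    using code_at_concat_blocks[OF lblk that, where xs = "[]"] by (simp add: H_def)
  have qm: "q l < m" if "l < N" for l
  proof -
    have "instr_regs (S ! l) \<subseteq> {..<m}"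
      using m(2) that by (simp add: regs_below_def N_B_Z_def)
    then show ?thesis
      using m(1) by (auto simp: q_def instr_regs_def split: instr.split)
  qed
  let ?E = "encode a (window n m) (\<lambda>_. 0)"
  have goodC: "good (C t)" if "t \<le> \<tau>" for t
    using comp_good[OF good_start C(1)[OF that]] zero_less by simp
  have fstC: "fst (C t) < N" if "t < \<tau>" for t
    using C(2)[OF that] by (simp add: halted_def N_B_Z_def)
  have sim_step: "reach H {} (\<lambda>e. True \<and> above_min (?E (C t)) (?E (step S x (C t))) e)
      (step H {} (?E (C t))) (?E (step S x (C t)))" (is "reach H {} ?I _ _") if t: "t < \<tau>" for t
  proof -
    define l R where "l = fst (C t)" "R = snd (?E (C t))"
    have l: "l < N" using fstC[OF t] by (simp add: l_R_def)
    have al: "a (fst (C t)) = l * B" "Suc (l * B + (length Q + n) + 1) = a (Suc (fst (C t)))"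
      "l * B + (length Q + n) + 2 = a (Suc l)"
      using l by (simp_all add: a_def l_R_def N_B_Z_def min_def)
    have snd: "snd (C t) (q l) < \<alpha>"
      using goodC t by (simp add: good_def)
    define v :: "'a ordinal" where "v = (if snd (C t) (q l) \<in> x then 1 else 0)"
    \<comment> \<open>The alternative with the new content covers the moment when the answer is
      stored but register 0 is not yet cleared.\<close>
    have I: "?I (l', R')" if "l * B \<le> l'"
      "\<And>i. n \<le> i \<Longrightarrow> R' i = R i \<or> R' i = snd (?E (step S x (C t))) i" for l' R'
    proof (intro conjI TrueI above_min_encode)
      show "fst (?E (C t)) \<le> l'" using that(1) by (simp add: encode_def al)
      show "R' i = snd (?E (C t)) i \<or> R' i = snd (?E (step S x (C t))) i" if "n \<le> i" for i
        using \<open>\<And>i. n \<le> i \<Longrightarrow> R' i = R i \<or> _\<close>[OF that] by (simp add: l_R_def)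
    qed
    have I': "?I (l', R')" if "l * B \<le> l'" "\<And>i. n \<le> i \<Longrightarrow> R' i = R i" for l' R'
      using that by (intro I) auto
    let ?p = "l * B + (length Q + n)"
    note blk = code[OF l, unfolded blk_def N_B_Z_def(3)]
    note prems = n(2,1) goodC[OF less_imp_le[OF t]] qm[OF l] blk Q[OF snd]
    have reach_p: "reach H {} ?I (step H {} (?E (C t))) (?p, R(0 := v))"
      by (rule block_call(1)[where I = ?I and a = a and c = "C t", OF prems _ al(1), folded v_def l_R_def(2)]) (rule I')
    have code_p: "code_at H ?p (post l)"
      by (rule block_call(2)[where I = "\<lambda>_. True" and a = a and c = "C t", OF prems _ al(1)]) simp
    have Ri: "R i = 0" if "i < n" for i using that by (simp add: l_R_def encode_def window_def)
    have RZ: "R Z = 0" by (simp add: l_R_def encode_def window_def N_B_Z_def)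
    have Rj: "R (n + j) = snd (C t) j" if "j < m" for j
      using that by (simp add: l_R_def encode_def window_def)
    have st: "step S x (C t) = exec x (S ! l) (C t)"
      using C(2)[OF t] by (simp add: step_def l_R_def)
    have regs: "instr_regs (S ! l) \<subseteq> {..<m}"
      using m(2) l by (simp add: regs_below_def N_B_Z_def)
    have gp: "good (?p, R(0 := v))"
      using reach_good[OF reach_p] .
    have "reach H {} ?I (?p, R(0 := v)) (?E (step S x (C t)))"
    proof (cases "\<exists>j. S ! l = Oracle j")
      case True
      then obtain j where j: "S ! l = Oracle j" by blast
      then have jm: "j < m" "q l = j" using regs by (auto simp: instr_regs_def q_def)
      have code: "?p < length H" "H ! ?p = Copy 0 (n + j)" "Suc ?p < length H" "H ! Suc ?p = Copy Z 0"
        using code_p by (simp_all add: post_def j code_at_Cons)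
      have E': "?E (step S x (C t)) = (Suc (Suc ?p), R(n + j := v))"
      proof -
        have "step S x (C t) = (Suc l, (snd (C t))(j := v))"
          unfolding st j v_def using jm(2) by (cases "C t") (auto simp: l_R_def(1))
        then show ?thesis
          using jm(1) al(3) by (auto simp: encode_def l_R_def(2) window_def fun_eq_iff)
      qed
      have "R(0 := v, n + j := v, 0 := 0) = R(n + j := v)"
        using Ri[of 0] n by auto
      then have fin: "exec {} (Copy Z 0) (Suc ?p, R(0 := v, n + j := v)) = ?E (step S x (C t))"
        using RZ jm n by (simp add: E' N_B_Z_def)
      show ?thesis
      proof (rule reach_exec[where I = ?I, OF gp _ code(1,2)])
        show "?I (?p, R(0 := v))" using n by (intro I') auto
        assume "good (exec {} (Copy 0 (n + j)) (?p, R(0 := v)))"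
        then have g: "good (Suc ?p, R(0 := v, n + j := v))" using n by simp
        have "reach H {} ?I (Suc ?p, R(0 := v, n + j := v)) (?E (step S x (C t)))"
        proof (rule reach_exec[where I = ?I, OF g _ code(3,4)])
          show "?I (Suc ?p, R(0 := v, n + j := v))" using n by (intro I) (auto simp: E')
        qed (simp only: fin reach_refl)
        then show "reach H {} ?I (exec {} (Copy 0 (n + j)) (?p, R(0 := v))) (?E (step S x (C t)))"
          using n by simp
      qed
    next
      case False
      then have code: "?p < length H" "H ! ?p = Copy Z 0" "Suc ?p < length H"
        "H ! Suc ?p = translate a n Z (S ! l)"
        using code_p by (cases "S ! l"; simp add: post_def code_at_Cons)+
      have ex: "exec {} (Copy Z 0) (?p, R(0 := v)) = (Suc ?p, R)"
        using RZ Ri[of 0] n by (auto simp: N_B_Z_def)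
      have fin: "exec {} (translate a n Z (S ! l)) (Suc ?p, R) = ?E (step S x (C t))"
        using exec_translate[OF regs _ Rj RZ, of x "Suc ?p" a "{}"] False al(2)
        by (simp add: st) (auto simp: encode_def l_R_def window_def)
      show ?thesis
      proof (rule reach_exec[where I = ?I, OF gp _ code(1,2)])
        show "?I (?p, R(0 := v))" using n by (intro I') auto
        assume "good (exec {} (Copy Z 0) (?p, R(0 := v)))"
        then have g: "good (Suc ?p, R)" by (simp only: ex)
        have "reach H {} ?I (Suc ?p, R) (?E (step S x (C t)))"
        proof (rule reach_exec[where I = ?I, OF g _ code(3,4)])
          show "?I (Suc ?p, R)" by (intro I) auto
        qed (simp only: fin reach_refl)
        then show "reach H {} ?I (exec {} (Copy Z 0) (?p, R(0 := v))) (?E (step S x (C t)))"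
          by (simp only: ex)
      qed
    qed
    with reach_p show ?thesis by (rule reach_trans)
  qed
  have E0: "?E (C 0) = start [0]"
    by (auto simp: C(3) encode_def a_def window_def fun_eq_iff)
  have sim: "reach H {} (\<lambda>_. True) (start [0]) (?E (C t))" if "t \<le> \<tau>" for t
    unfolding E0[symmetric]
  proof (rule simulation_steps[where ci = "start [0]" and z = x and S = S])
    show "good (start [0 :: 'a ordinal])"
      using zero_less by (intro good_start) auto
    show "mono a" by (auto simp: a_def mono_def min_def)
  qed (use that C(1) zero_less sim_step in auto)
  have "halted H (?E (C \<tau>))"
    using C(4) by (simp add: halted_def lH encode_def a_def N_B_Z_def)
  then obtain \<tau>' d where H: "halts_at \<alpha> H {} [0] \<tau>' d"
    using halts_with_reach[OF sim[OF order.refl]] by blast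
  have "\<exists>t<\<tau>'. \<exists>d. run \<alpha> H {} [0] t = Some d \<and> snd d 0 = \<iota>" if \<iota>: "\<iota> < \<alpha>" for \<iota>
  proof -
    obtain t j where t: "t < \<tau>" "S ! fst (C t) = Oracle j" "snd (C t) j = \<iota>"
      using recognizer_queries_everything[OF S x \<iota> C(1,3,2,4)] by metis
    let ?l = "fst (C t)"
    have l: "?l < N" using fstC[OF t(1)] .
    have j: "q ?l = j" "j < m" using qm[OF l] t(2) by (auto simp: q_def)
    have code': "?l * B < length H" "H ! (?l * B) = Copy (n + j) 0"
      using code[OF l] by (simp_all add: blk_def j code_at_Cons)
    have st: "step H {} (?E (C t)) = (Suc (?l * B), (snd (?E (C t)))(0 := \<iota>))"
      using l j t(3) code' by (simp add: step_def halted_def encode_def a_def window_def fun_eq_iff min_def)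
    have r: "reach H {} (\<lambda>_. True) (start [0]) (?E (C t))"
      using t(1) by (intro sim) simp
    have "reach H {} (\<lambda>_. True) (?E (C t)) (step H {} (?E (C t)))"
      by (rule reach_step[OF reach_good[OF r]]) (auto intro: reach_refl good_step reach_good[OF r])
    with r have "reach H {} (\<lambda>_. True) (start [0]) (step H {} (?E (C t)))"
      by (rule reach_trans)
    then obtain T where T: "good (start [0])" "comp H {} (start [0]) T = Some (step H {} (?E (C t)))"
      by (auto simp: reach_def segment_def)
    \<comment> \<open>Register 0 must show \<open>\<iota>\<close> strictly before the machine stops.
      After the load further lines of the block remain, so this configuration is not halted and its
      time lies before the halting time.\<close>
    have nh: "\<not> halted H (step H {} (?E (C t)))"
    proof -
      have "Suc (?l * B) < Suc ?l * B" using n by (simp add: N_B_Z_def)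
      also have "\<dots> \<le> N * B" using l by (intro mult_le_mono1) simp
      finally show ?thesis by (simp add: st halted_def lH)
    qed
    have "T < \<tau>'"
    proof (rule ccontr)
      assume "\<not> T < \<tau>'"
      then have "\<tau>' \<le> T" by simp
      then obtain u where "T = ord_add \<tau>' u" by (rule le_imp_ord_add)
      moreover have d: "comp H {} (start [0]) \<tau>' = Some d" "halted H d"
        using H by (auto simp: halts_at_def run_eq_computation)
      ultimately have "comp H {} (start [0]) T = Some d"
        using comp_add[OF T(1) d(1), where t = u] comp_halted[OF comp_good[OF T(1) d(1)] d(2)] by simp
      then have "step H {} (?E (C t)) = d"
        unfolding T(2) by simp
      with d(2) nh show False by simp
    qed
    with T(2) show ?thesis
      by (auto simp: run_eq_computation st)
  qed
  with H show ?thesis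
    unfolding wITRM_searchable_def by blast
qed

lemma recognizable_if_searchable:
  assumes "wITRM_computable \<alpha> x" "wITRM_searchable \<alpha>"
  shows "wITRM_recognizable \<alpha> x"
proof -
  obtain Q where x: "x \<subseteq> {..<\<alpha>}"
    and Q: "\<And>\<iota>. \<iota> < \<alpha> \<Longrightarrow> halts_with \<alpha> Q {} [\<iota>, 0] (if \<iota> \<in> x then 1 else 0)"
    using assms(1) by (auto simp: wITRM_computable_def)
  obtain S \<tau> c where S: "halts_at \<alpha> S {} [0] \<tau> c"
    "\<And>\<iota>. \<iota> < \<alpha> \<Longrightarrow> \<exists>t<\<tau>. \<exists>d. run \<alpha> S {} [0] t = Some d \<and> snd d 0 = \<iota>"
    using assms(2) by (auto simp: wITRM_searchable_def)
  obtain n where n: "2 \<le> n" "regs_below n Q" using regs_below_exists by blast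
  obtain m where m: "1 \<le> m" "regs_below m S" using regs_below_exists by blast
  obtain C where C: "\<And>t. t \<le> \<tau> \<Longrightarrow> comp S {} (start [0]) t = Some (C t)"
      "\<And>t. t < \<tau> \<Longrightarrow> \<not> halted S (C t)" "C 0 = start [0]" "halted S (C \<tau>)"
    using S(1) by (rule halts_at_trajectory) blast
  have search: "\<exists>t<\<tau>. snd (C t) 0 = \<iota>" if \<iota>: "\<iota> < \<alpha>" for \<iota>
  proof -
    obtain t d where "t < \<tau>" "run \<alpha> S {} [0] t = Some d" "snd d 0 = \<iota>"
      using S(2)[OF \<iota>] by blast
    then show ?thesis
      using C(1)[of t] by (auto simp: run_eq_computation)
  qed
  define N B Z where "N = length S" "B = length Q + n + 8" "Z = n + m"
  define a where "a l = min l N * B" for l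
  \<comment> \<open>Register \<open>n\<close> is the simulated search register. The oracle's answer
    in register 1 is compared with that of \<open>Q\<close> in register 0; agreement jumps to offset
    5, the clean-up. Otherwise the output is set to 0, and the unconditional
    \<open>JumpEq Z Z\<close> halts at \<open>N * B + 1\<close>, the length of
    \<open>H\<close>.\<close>
  define post where "post l = [Copy n 1, Oracle 1, JumpEq 0 1 (l * B + (length Q + n) + 5),
    Copy Z 0, JumpEq Z Z (N * B + 1), Copy Z 0, Copy Z 1, translate a n Z (S ! l)]" for l
  define blk where "blk l = Copy (n + 0) 0 # subroutine Q n Z (Suc (l * B)) @ post l" for l
  \<comment> \<open>A search that ends without disagreement arrives at line \<open>N * B\<close>
    with 0 in register 0; the additional \<open>Incr 0\<close> produces the output 1.\<close>
  define H where "H = concat (map blk [0..<N]) @ [Incr 0]"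
  have lblk: "length (blk l) = B" for l
    using n by (simp add: blk_def length_subroutine post_def N_B_Z_def)
  have lH: "length H = N * B + 1"
    unfolding H_def by (simp add: length_concat_blocks[OF lblk])
  have code: "code_at H (l * B) (blk l)" if "l < N" for l
    using code_at_concat_blocks[OF lblk that] by (simp add: H_def)
  have last: "H ! (N * B) = Incr 0"
    using length_concat_blocks[of blk B N] lblk by (simp add: H_def nth_append)
  let ?E = "encode a (window n m) (\<lambda>_. 0)"
  have goodC: "good (C t)" if "t \<le> \<tau>" for t
    using comp_good[OF good_start C(1)[OF that]] zero_less by simp
  have fstC: "fst (C t) < N" if "t < \<tau>" for t
    using C(2)[OF that] by (simp add: halted_def N_B_Z_def)
  have E0: "?E (C 0) = start [0]"
    by (auto simp: C(3) encode_def a_def window_def fun_eq_iff)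
  \<comment> \<open>On disagreement register 1 keeps the oracle's answer, since the machine has then
    halted and no later block relies on clean scratch registers.\<close>
  have block: "reach H y (\<lambda>e. True \<and> above_min (?E (C t)) (?E (step S {} (C t))) e)
      (step H y (?E (C t)))
      (if snd (C t) 0 \<in> x \<longleftrightarrow> snd (C t) 0 \<in> y then ?E (step S {} (C t))
       else (N * B + 1, (snd (?E (C t)))(1 := if snd (C t) 0 \<in> y then 1 else 0)))"
    (is "reach H y ?I _ ?goal") if t: "t < \<tau>" for t y
  proof -
    define l R \<iota> where "l = fst (C t)" "R = snd (?E (C t))" "\<iota> = snd (C t) 0"
    have l: "l < N" using fstC[OF t] by (simp add: l_R_\<iota>_def)
    have al: "a (fst (C t)) = l * B" "Suc (l * B + (length Q + n) + 7) = a (Suc (fst (C t)))"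
      using l by (simp_all add: a_def l_R_\<iota>_def N_B_Z_def min_def)
    have \<iota>: "snd (C t) 0 < \<alpha>"
      using goodC t by (simp add: good_def)
    define v w :: "'a ordinal" where
      "v = (if snd (C t) 0 \<in> x then 1 else 0)" "w = (if snd (C t) 0 \<in> y then 1 else 0)"
    have I: "?I (l', R')" if "l * B \<le> l'" "\<And>i. n \<le> i \<Longrightarrow> R' i = R i" for l' R'
    proof (intro conjI TrueI above_min_encode)
      show "fst (?E (C t)) \<le> l'" using that(1) by (simp add: encode_def al)
      show "R' i = snd (?E (C t)) i \<or> R' i = snd (?E (step S {} (C t))) i" if "n \<le> i" for i
        using \<open>\<And>i. n \<le> i \<Longrightarrow> R' i = R i\<close>[OF that] by (simp add: l_R_\<iota>_def)
    qed
    let ?p = "l * B + (length Q + n)"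
    note blk = code[OF l, unfolded blk_def N_B_Z_def(3)]
    have m0: "0 < m" using m(1) by simp
    note prems = n(2,1) goodC[OF less_imp_le[OF t]] m0 blk Q[OF \<iota>]
    have reach_p: "reach H y ?I (step H y (?E (C t))) (?p, R(0 := v))"
      by (rule block_call(1)[where I = ?I and a = a and c = "C t",
          OF prems _ al(1), folded v_w_def l_R_\<iota>_def(2)]) (rule I)
    have code_p: "code_at H ?p (post l)"
      by (rule block_call(2)[where I = "\<lambda>_. True" and a = a and c = "C t", OF prems _ al(1)]) simp
    have Ri: "R i = 0" if "i < n" for i using that by (simp add: l_R_\<iota>_def encode_def window_def)
    have R0: "R 0 = 0" "R 1 = 0" using Ri n by auto
    have RZ: "R Z = 0" "Z \<noteq> 0" "Z \<noteq> 1"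
      using n by (simp_all add: l_R_\<iota>_def encode_def window_def N_B_Z_def)
    have Rj: "R (n + j) = snd (C t) j" if "j < m" for j
      using that by (simp add: l_R_\<iota>_def encode_def window_def)
    have Rn: "R n = \<iota>" "n \<noteq> 0" "n \<noteq> 1"
      using Rj[OF m0] n by (auto simp: l_R_\<iota>_def)
    have st: "step S {} (C t) = exec {} (S ! l) (C t)"
      using C(2)[OF t] by (simp add: step_def l_R_\<iota>_def)
    have regs: "instr_regs (S ! l) \<subseteq> {..<m}"
      using m(2) l by (simp add: regs_below_def N_B_Z_def)
    have "l * B + B \<le> N * B" 
      using l by (metis Suc_leI add.commute mult_Suc mult_le_mono1)
    then have len: "?p + k < length H" if "k < 8" for k
      using that by (simp add: lH N_B_Z_def)
    have at: "H ! ?p = Copy n 1" "H ! (?p + 1) = Oracle 1" "H ! (?p + 2) = JumpEq 0 1 (?p + 5)"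
      "H ! (?p + 3) = Copy Z 0" "H ! (?p + 4) = JumpEq Z Z (N * B + 1)" "H ! (?p + 5) = Copy Z 0"
      "H ! (?p + 6) = Copy Z 1" "H ! (?p + 7) = translate a n Z (S ! l)"
      using code_p by (simp_all add: post_def code_at_Cons eval_nat_numeral)
    have go: "reach H y ?I (?p + k, R') d"
      if "k < 8" "H ! (?p + k) = i" "\<And>i. n \<le> i \<Longrightarrow> R' i = R i" "good (?p + k, R')"
        "exec y i (?p + k, R') = e" "good e \<Longrightarrow> reach H y ?I e d" for k R' i e d
    proof (rule reach_exec[where I = ?I, OF that(4) _ len[OF that(1)] that(2)])
      show "?I (?p + k, R')" using that(3) by (intro I) auto
    qed (use that(5,6) in simp)
    have gp: "good (?p + 0, R(0 := v))"
      using reach_good[OF reach_p] by simp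
    \<comment> \<open>Oracle commands of \<open>S\<close> have become copies from \<open>Z\<close>,
      so the search proceeds as with the empty oracle although \<open>H\<close> runs with
      \<open>y\<close>.\<close>
    have fin: "exec y (translate a n Z (S ! l)) (?p + 7, R) = ?E (step S {} (C t))"
      using exec_translate[OF regs _ Rj RZ(1), of "{}" "?p + 7" a y] al(2)
      by (simp add: st) (auto simp: encode_def l_R_\<iota>_def window_def)
    have cmp: "reach H y ?I (?p + 2, R(0 := v, 1 := w)) ?goal" (is "reach H y ?I (_, ?R) _")
      if g: "good (?p + 2, R(0 := v, 1 := w))"
    proof (cases "v = w")
      case True
      then have goal: "?goal = ?E (step S {} (C t))"
        using zero_less_one by (simp add: v_w_def split: if_splits)
      show ?thesis unfolding goal
      proof (rule go[OF _ at(3) _ g])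
        assume g: "good (?p + 5, ?R)"
        show "reach H y ?I (?p + 5, ?R) (?E (step S {} (C t)))"
        proof (rule go[OF _ at(6) _ g])
          assume g: "good (?p + 6, R(1 := w))"
          show "reach H y ?I (?p + 6, R(1 := w)) (?E (step S {} (C t)))"
          proof (rule go[OF _ at(7) _ g])
            assume g: "good (?p + 7, R)"
            show "reach H y ?I (?p + 7, R) (?E (step S {} (C t)))"
              by (rule go[OF _ at(8) _ g fin]) (auto intro: reach_refl)
          qed (use n R0 RZ in auto)
        qed (use n R0 RZ in auto)
      qed (use n True in auto)
    next
      case False
      then have goal: "?goal = (N * B + 1, R(1 := w))"
        by (auto simp: v_w_def l_R_\<iota>_def)
      show ?thesis unfolding goal
      proof (rule go[OF _ at(3) _ g])
        assume g: "good (?p + 3, ?R)"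
        show "reach H y ?I (?p + 3, ?R) (N * B + 1, R(1 := w))"
        proof (rule go[OF _ at(4) _ g])
          assume g: "good (?p + 4, R(1 := w))"
          show "reach H y ?I (?p + 4, R(1 := w)) (N * B + 1, R(1 := w))"
            by (rule go[OF _ at(5) _ g]) (use n in \<open>auto intro: reach_refl\<close>)
        qed (use n R0 RZ in auto)
      qed (use n False in auto)
    qed
    have ex: "exec y (Oracle 1) (?p + 1, R(0 := v, 1 := \<iota>)) = (?p + 2, R(0 := v, 1 := w))"
      by (simp add: v_w_def(2) l_R_\<iota>_def(3))
    have "reach H y ?I (?p + 0, R(0 := v)) ?goal"
    proof (rule go[OF _ _ _ gp])
      assume g: "good (?p + 1, R(0 := v, 1 := \<iota>))"
      show "reach H y ?I (?p + 1, R(0 := v, 1 := \<iota>)) ?goal"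
      proof (rule go[OF _ at(2) _ g ex cmp])
        show "(R(0 := v, 1 := \<iota>)) i = R i" if "n \<le> i" for i
          using that n(1) by simp
      qed simp_all
    qed (use n at(1) Rn in auto)
    then have "reach H y ?I (?p, R(0 := v)) ?goal"
      by (simp only: add_0_right)
    with reach_p show ?thesis
      by (rule reach_trans)
  qed
  have sim: "reach H y (\<lambda>_. True) (start [0]) (?E (C T))"
    if T: "T \<le> \<tau>" "\<And>t. t < T \<Longrightarrow> snd (C t) 0 \<in> x \<longleftrightarrow> snd (C t) 0 \<in> y" for T y
    unfolding E0[symmetric]
  proof (rule simulation_steps[where ci = "start [0]" and z = "{}" and S = S])
    show "good (start [0 :: 'a ordinal])"
      using zero_less by (intro good_start) auto
    show "mono a" by (auto simp: a_def mono_def min_def)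
    show "reach H y (\<lambda>e. True \<and> above_min (?E (C t)) (?E (step S {} (C t))) e)
      (step H y (?E (C t))) (?E (step S {} (C t)))" if "t < T" for t
      using block[of t y] T(1) T(2)[OF that] that by simp
  qed (use T C(1) zero_less in auto)
  have "halts_with \<alpha> H y [0] (if y = x then 1 else 0)" if y: "y \<subseteq> {..<\<alpha>}" for y
  proof (cases "y = x")
    case True
    have r: "reach H y (\<lambda>_. True) (start [0]) (?E (C \<tau>))"
      by (rule sim) (simp_all add: True)
    have E: "?E (C \<tau>) = (N * B, snd (?E (C \<tau>)))"
      using C(4) by (simp add: encode_def a_def halted_def N_B_Z_def)
    have "snd (?E (C \<tau>)) 0 = 0" using n by (simp add: encode_def window_def)
    then have st: "step H y (?E (C \<tau>)) = (N * B + 1, (snd (?E (C \<tau>)))(0 := 1))"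
      by (subst E) (simp add: step_def halted_def lH last one_ordinal_def)
    have "reach H y (\<lambda>_. True) (?E (C \<tau>)) (step H y (?E (C \<tau>)))"
      by (rule reach_step[OF reach_good[OF r]]) (auto intro: reach_refl good_step reach_good[OF r])
    with r have "reach H y (\<lambda>_. True) (start [0]) (step H y (?E (C \<tau>)))"
      by (rule reach_trans)
    from halts_with_reach[OF this[unfolded st]] show ?thesis
      by (simp add: True halted_def lH halts_with_def)
  next
    case False
    then obtain \<iota> where \<iota>: "\<not> (\<iota> \<in> x \<longleftrightarrow> \<iota> \<in> y)" by blast
    then have "\<iota> < \<alpha>" using x y by auto
    then obtain t1 where t1: "t1 < \<tau>" "snd (C t1) 0 = \<iota>" using search by blast
    \<comment> \<open>All blocks before the first disagreement follow the simulation, which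
      therefore reaches time \<open>T\<close>; the block executed there ends the run.\<close>
    define T where "T = (LEAST t. \<not> (snd (C t) 0 \<in> x \<longleftrightarrow> snd (C t) 0 \<in> y))"
    have T: "\<not> (snd (C T) 0 \<in> x \<longleftrightarrow> snd (C T) 0 \<in> y)"
      unfolding T_def by (rule LeastI[of _ t1]) (use t1 \<iota> in blast)
    have "T \<le> t1"
      unfolding T_def by (rule Least_le) (use t1 \<iota> in blast)
    with t1(1) have T\<tau>: "T < \<tau>" by simp
    have r: "reach H y (\<lambda>_. True) (start [0]) (?E (C T))"
    proof (rule sim)
      show "T \<le> \<tau>" using T\<tau> by simp
      show "snd (C t) 0 \<in> x \<longleftrightarrow> snd (C t) 0 \<in> y" if "t < T" for t
        using not_less_Least[OF that[unfolded T_def]] by blast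
    qed
    let ?d = "(N * B + 1, (snd (?E (C T)))(1 := if snd (C T) 0 \<in> y then 1 else 0))"
    have "reach H y (\<lambda>_. True) (step H y (?E (C T))) ?d"
      using reach_mono[OF block[OF T\<tau>, of y], of "\<lambda>_. True"] T by simp
    then have "reach H y (\<lambda>_. True) (?E (C T)) ?d"
      by (intro reach_step[OF reach_good[OF r]]) auto
    with r have "reach H y (\<lambda>_. True) (start [0]) ?d"
      by (rule reach_trans)
    from halts_with_reach[OF this] show ?thesis
      using n False by (simp add: halted_def lH halts_with_def encode_def window_def)
  qed
  with x show ?thesis
    unfolding wITRM_recognizable_def by blast
qed

text \<open>Register 1 holds the second input 0, which can simply be copied to the output
  register.\<close>

lemma empty_computable: "wITRM_computable \<alpha> {}"
proof -
  have "halts_with \<alpha> [Copy 1 0] {} [\<iota>, 0] 0" if "\<iota> < \<alpha>" for \<iota>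
  proof -
    have g: "good (start [\<iota>, 0])"
      using that zero_less by (intro good_start) auto
    have "reach [Copy 1 0] {} (\<lambda>_. True) (start [\<iota>, 0]) (exec {} (Copy 1 0) (start [\<iota>, 0]))"
      by (rule reach_exec[OF g]) (auto intro: reach_refl)
    from halts_with_reach[OF this] show ?thesis
      by (simp add: halted_def halts_with_def)
  qed
  then show ?thesis
    by (auto simp: wITRM_computable_def intro!: exI[of _ "[Copy 1 0]"])
qed

end

theorem corollary6:
  fixes \<alpha> :: "'a ordinal"
  assumes "exponentially_closed \<alpha>"
  shows "((\<forall>x\<subseteq>{..<\<alpha>}. wITRM_computable \<alpha> x \<longrightarrow> wITRM_recognizable \<alpha> x) \<longleftrightarrow>
            wITRM_recognizable \<alpha> {}) \<and>
         (wITRM_recognizable \<alpha> {} \<longleftrightarrow>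
            (\<exists>x\<subseteq>{..<\<alpha>}. wITRM_computable \<alpha> x \<and> wITRM_recognizable \<alpha> x)) \<and>
         ((\<exists>x\<subseteq>{..<\<alpha>}. wITRM_computable \<alpha> x \<and> wITRM_recognizable \<alpha> x) \<longleftrightarrow>
            wITRM_searchable \<alpha>)"
proof -
  interpret infinite_ordinal \<alpha>
    using assms by unfold_locales (simp add: exponentially_closed_def)
  interpret register_machine \<alpha>
    by unfold_locales (rule exponentially_closed_ord_succ[OF assms])
  show ?thesis
    using empty_computable searchable_if_recognizable recognizable_if_searchable by blast
qed

end
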